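(* Let $\varphi\in\mathcal I$ and let $\mu$ be a nonzero finite Borel measure on $S^{n-1}$ which is not concentrated on any closed hemisphere. Let $G\in\mathcal G_I$ be a continuous function such that, for some $q\ge n-1$, $$\inf\Big\{\frac{G(t,u)}{t^q}:\ t\ge 1,\ u\in S^{n-1}\Big\}>0.$$ Then the following statements hold. i) There exists $\widetilde M\in\widetilde{\mathcal B}$ such that $$\|h_{\widetilde M}\|_{\mu,\varphi}=\inf\big\{\|h_Q\|_{\mu,\varphi}:\ Q\in\widetilde{\mathcal B}\big\}.$$ If, in addition, $\varphi$ is convex on $(0,\infty)$ and $t\mapsto G(t,u)$ is convex on $(0,\infty)$ for each $u\in S^{n-1}$, then such $\widetilde M\in\widetilde{\mathcal B}$ is unique. ii) There exists $\widehat M\in\widehat{\mathcal B}$ such that $$\|h_{\widehat M}\|_{\mu,\varphi}=\inf\big\{\|h_Q\|_{\mu,\varphi}:\ Q\in\widehat{\mathcal B}\big\}.$$ If, in addition, $\varphi$ is convex on $(0,\infty)$ and $t\mapsto G(t,u)$ is convex on $(0,\infty)$ for each $u\in S^{n-1}$, then such $\widehat M\in\widehat{\mathcal B}$ is unique.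
   Context: Work in $\mathbb R^n$, $n\ge2$, with inner product $\langle\cdot,\cdot\rangle$, unit ball $B^n$ and unit sphere $S^{n-1}$; $du$ denotes the spherical measure on $S^{n-1}$ (the $(n-1)$-dimensional Hausdorff measure). $\mathcal K_{(o)}^n$ is the set of compact convex subsets of $\mathbb R^n$ with the origin $o$ in their interiors. For $K\in\mathcal K_{(o)}^n$ and $u\in S^{n-1}$: $h_K(u)=\max_{x\in K}\langle x,u\rangle$, $\rho_K(u)=\max\{\lambda\ge0:\lambda u\in K\}$, and $K^\circ=\{x\in\mathbb R^n:\langle x,y\rangle\le1\ \forall y\in K\}$. $\mathcal I$ is the set of continuous strictly increasing functions $\varphi:(0,\infty)\to(0,\infty)$ with $\lim_{t\to0^+}\varphi(t)=0$, $\varphi(1)=1$, $\lim_{t\to\infty}\varphi(t)=\infty$. For $\varphi\in\mathcal I$, a nonzero finite Borel measure $\mu$ on $S^{n-1}$ and $Q\in\mathcal K_{(o)}^n$, the "Orlicz norm" is $$\|h_Q\|_{\mu,\varphi}=\inf\Big\{\lambda>0:\ \frac1{\mu(S^{n-1})}\int_{S^{n-1}}\varphi\Big(\frac{h_Q(u)}{\lambda}\Big)\,d\mu(u)\le1\Big\}.$$ $\mathcal G_I$ is the set of continuous $G:(0,\infty)\times S^{n-1}\to(0,\infty)$ such that for each $u\in S^{n-1}$, $t\mapsto G(t,u)$ is strictly increasing with $\lim_{t\to0^+}G(t,u)=0$ and $\lim_{t\to\infty}G(t,u)=\infty$. The general dual volume is $\widetilde V_G(K)=\int_{S^{n-1}}G(\rho_K(u),u)\,du$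 for $K\in\mathcal K_{(o)}^n$. For $G\in\mathcal G_I$ the homogeneous general dual volume is $\widehat V_G(K)=\inf\{\eta>0:\int_{S^{n-1}}G(\rho_K(u)/\eta,u)\,du\le1\}$. Set $$\widetilde{\mathcal B}=\{Q\in\mathcal K_{(o)}^n:\widetilde V_G(Q^\circ)=\widetilde V_G(B^n)\},\qquad \widehat{\mathcal B}=\{Q\in\mathcal K_{(o)}^n:\widehat V_G(Q^\circ)=\widehat V_G(B^n)\}.$$ A finite Borel measure $\mu$ on $S^{n-1}$ is not concentrated on any closed hemisphere if $\mu(\{u\in S^{n-1}:\langle u,v\rangle>0\})>0$ for every $v\in S^{n-1}$. *)

theory Defs
  imports "HOL-Analysis.Analysis"
begin

section \<open>Hausdorff measure\<close>

text \<open>The normalisation is the one for which the m-dimensional Hausdorff measure on Euclidean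
  m-space is Lebesgue measure. The case distinction is needed for \<open>m = 0\<close>, where a nonempty set
  has weight \<open>1\<close>.\<close>

definition hausdorff_weight :: "nat \<Rightarrow> 'a::metric_space set \<Rightarrow> ennreal" where
  "hausdorff_weight m C =
     (if C = {} then 0 else ennreal (unit_ball_vol (real m) * (diameter C / 2) ^ m))"

text \<open>Boundedness is required because \<^const>\<open>diameter\<close> is unspecified on unbounded sets.\<close>

definition hausdorff_covers :: "real \<Rightarrow> 'a::metric_space set \<Rightarrow> (nat \<Rightarrow> 'a set) set" where
  "hausdorff_covers \<delta> A = {C. A \<subseteq> (\<Union>i. C i) \<and> (\<forall>i. bounded (C i) \<and> diameter (C i) \<le> \<delta>)}"

definition hausdorff_content :: "nat \<Rightarrow> real \<Rightarrow> 'a::metric_space set \<Rightarrow> ennreal" where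
  "hausdorff_content m \<delta> A = (INF C\<in>hausdorff_covers \<delta> A. \<Sum>i. hausdorff_weight m (C i))"

definition hausdorff_outer_measure :: "nat \<Rightarrow> 'a::metric_space set \<Rightarrow> ennreal" where
  "hausdorff_outer_measure m A = (SUP \<delta>\<in>{0<..}. hausdorff_content m \<delta> A)"

text \<open>\<^const>\<open>measure_of\<close> yields the null measure if the given set function is not
  \<open>\<sigma>\<close>-additive on the given sets; that this does not happen here is the lemma
  \<open>emeasure_hausdorff_measure\<close> below.\<close>

definition hausdorff_measure :: "nat \<Rightarrow> 'a::metric_space measure" where
  "hausdorff_measure m = measure_of UNIV (sets borel) (hausdorff_outer_measure m)"

lemma hausdorff_weight_mono:
  assumes "A \<subseteq> B" "bounded B"
  shows "hausdorff_weight m A \<le> hausdorff_weight m B"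
proof (cases "A = {}")
  case True
  then show ?thesis by (simp add: hausdorff_weight_def)
next
  case False
  have "diameter A \<le> diameter B"
    using assms by (rule diameter_subset)
  moreover have "0 \<le> diameter A"
    using assms bounded_subset diameter_ge_0 by blast
  ultimately have "(diameter A / 2) ^ m \<le> (diameter B / 2) ^ m"
    by (intro power_mono) auto
  with False assms show ?thesis
    by (auto simp: hausdorff_weight_def intro!: ennreal_leI mult_left_mono)
qed

lemma hausdorff_content_le:
  assumes "A \<subseteq> (\<Union>i. C i)" "\<And>i. bounded (C i)" "\<And>i. diameter (C i) \<le> \<delta>"
  shows "hausdorff_content m \<delta> A \<le> (\<Sum>i. hausdorff_weight m (C i))"
  unfolding hausdorff_content_def hausdorff_covers_def
  using assms by (intro INF_lower) auto

lemma hausdorff_content_mono: "A \<subseteq> B \<Longrightarrow> hausdorff_content m \<delta> A \<le> hausdorff_content m \<delta> B"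
  unfolding hausdorff_content_def hausdorff_covers_def
  by (intro INF_superset_mono) auto

lemma hausdorff_content_antimono:
  "\<delta> \<le> \<epsilon> \<Longrightarrow> hausdorff_content m \<epsilon> A \<le> hausdorff_content m \<delta> A"
  unfolding hausdorff_content_def hausdorff_covers_def
  by (intro INF_superset_mono) (auto intro: order_trans)

lemma hausdorff_content_UN:
  "hausdorff_content m \<delta> (\<Union>n. A n) \<le> (\<Sum>n. hausdorff_content m \<delta> (A n))"
proof (rule ennreal_le_epsilon)
  fix e :: real
  assume fin: "(\<Sum>n. hausdorff_content m \<delta> (A n)) < top" and e: "0 < e"
  have "\<exists>C\<in>hausdorff_covers \<delta> (A n). (\<Sum>i. hausdorff_weight m (C i))
          < hausdorff_content m \<delta> (A n) + ennreal (e * (1 / 2) ^ Suc n)" for n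
  proof -
    have "hausdorff_content m \<delta> (A n) < top"
      using fin by (rule ennreal_suminf_lessD)
    then have "hausdorff_content m \<delta> (A n)
        < hausdorff_content m \<delta> (A n) + ennreal (e * (1 / 2) ^ Suc n)"
      using e by (simp add: ennreal_add_left_cancel_less[of _ 0, simplified])
    then show ?thesis
      by (subst (asm) (1) hausdorff_content_def) (simp add: INF_less_iff)
  qed
  then obtain C where C: "\<And>n. C n \<in> hausdorff_covers \<delta> (A n)"
    and le: "\<And>n. (\<Sum>i. hausdorff_weight m (C n i))
          < hausdorff_content m \<delta> (A n) + ennreal (e * (1 / 2) ^ Suc n)"
    by metis
  define D where "D = case_prod C \<circ> prod_decode"
  have "hausdorff_content m \<delta> (\<Union>n. A n) \<le> (\<Sum>i. hausdorff_weight m (D i))"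
  proof (rule hausdorff_content_le)
    show "(\<Union>n. A n) \<subseteq> (\<Union>i. D i)"
    proof safe
      fix x n assume "x \<in> A n"
      then obtain i where "x \<in> C n i"
        using C[of n] by (auto simp: hausdorff_covers_def)
      then have "x \<in> D (prod_encode (n, i))"
        by (simp add: D_def)
      then show "x \<in> (\<Union>i. D i)" by blast
    qed
    show "bounded (D i)" "diameter (D i) \<le> \<delta>" for i
      using C by (auto simp: D_def hausdorff_covers_def split: prod.split)
  qed
  also have "\<dots> = (\<Sum>n. \<Sum>i. hausdorff_weight m (C n i))"
    unfolding D_def
    by (subst suminf_ennreal_2dimen[where f = "\<lambda>(n, i). hausdorff_weight m (C n i)", symmetric])
       (auto simp: o_def split_beta)
  also have "\<dots> \<le> (\<Sum>n. hausdorff_content m \<delta> (A n) + ennreal (e * (1 / 2) ^ Suc n))"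
    using le by (intro suminf_le less_imp_le) auto
  also have "\<dots> = (\<Sum>n. hausdorff_content m \<delta> (A n)) + (\<Sum>n. ennreal (e * (1 / 2) ^ Suc n))"
    by (intro suminf_add[symmetric]) auto
  also have "(\<Sum>n. ennreal (e * (1 / 2) ^ Suc n)) = ennreal e"
    using sums_mult[OF power_half_series, of e] e
    by (intro suminf_ennreal_eq) auto
  finally show "hausdorff_content m \<delta> (\<Union>n. A n)
      \<le> (\<Sum>n. hausdorff_content m \<delta> (A n)) + ennreal e" .
qed

lemma hausdorff_outer_measure_empty [simp]: "hausdorff_outer_measure m {} = 0"
proof -
  have "hausdorff_content m \<delta> {} = 0" if "0 < \<delta>" for \<delta>
    using hausdorff_content_le[of "{}" "\<lambda>_. {}" \<delta> m] that by (simp add: hausdorff_weight_def)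
  then have "hausdorff_outer_measure m {} = (SUP \<delta>\<in>{0::real<..}. 0)"
    unfolding hausdorff_outer_measure_def by (intro SUP_cong) auto
  also have "\<dots> = 0"
    by (rule cSUP_const) auto
  finally show ?thesis .
qed

lemma hausdorff_outer_measure_mono:
  "A \<subseteq> B \<Longrightarrow> hausdorff_outer_measure m A \<le> hausdorff_outer_measure m B"
  unfolding hausdorff_outer_measure_def
  by (intro SUP_mono) (auto intro: hausdorff_content_mono)

lemma hausdorff_outer_measure_UN:
  "hausdorff_outer_measure m (\<Union>i. A i) \<le> (\<Sum>i. hausdorff_outer_measure m (A i))"
  unfolding hausdorff_outer_measure_def[of m "\<Union>i. A i"]
  by (rule SUP_least, rule order_trans[OF hausdorff_content_UN])
     (auto simp: hausdorff_outer_measure_def intro!: suminf_le SUP_upper)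

lemma outer_measure_space_hausdorff: "outer_measure_space UNIV (hausdorff_outer_measure m)"
  unfolding outer_measure_space_def positive_def increasing_def countably_subadditive_def
  by (auto intro: hausdorff_outer_measure_mono hausdorff_outer_measure_UN)

lemma hausdorff_outer_measure_Un:
  "hausdorff_outer_measure m (A \<union> B) \<le> hausdorff_outer_measure m A + hausdorff_outer_measure m B"
proof -
  have "(\<Union>i::nat. if i = 0 then A else if i = 1 then B else {}) = A \<union> B"
    by (auto split: if_splits)
  moreover have "(\<Sum>i. hausdorff_outer_measure m (if i = 0 then A else if i = 1 then B else {}))
      = hausdorff_outer_measure m A + hausdorff_outer_measure m B"
    by (subst suminf_finite[of "{0, 1}"]) auto
  ultimately show ?thesis
    using hausdorff_outer_measure_UN[of m "\<lambda>i::nat. if i = 0 then A else if i = 1 then B else {}"]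
    by simp
qed

lemma hausdorff_outer_measure_separated:
  assumes r: "0 < r" and sep: "\<And>x y. x \<in> A \<Longrightarrow> y \<in> B \<Longrightarrow> r \<le> dist x y"
  shows "hausdorff_outer_measure m A + hausdorff_outer_measure m B
      \<le> hausdorff_outer_measure m (A \<union> B)"
proof -
  have *: "hausdorff_content m \<delta> A + hausdorff_content m \<delta> B \<le> hausdorff_content m \<delta> (A \<union> B)"
    if \<delta>: "\<delta> < r" for \<delta>
    unfolding hausdorff_content_def[of m \<delta> "A \<union> B"]
  proof (rule INF_greatest)
    fix C assume C: "C \<in> hausdorff_covers \<delta> (A \<union> B)"
    then have bd: "bounded (C i)" "diameter (C i) \<le> \<delta>" for i
      by (auto simp: hausdorff_covers_def)
    have bd': "bounded (C i \<inter> X)" "diameter (C i \<inter> X) \<le> \<delta>" for i X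
      using bd[of i] diameter_subset[of "C i \<inter> X" "C i"] by (auto simp: bounded_Int)
    have "hausdorff_content m \<delta> A + hausdorff_content m \<delta> B
       \<le> (\<Sum>i. hausdorff_weight m (C i \<inter> A)) + (\<Sum>i. hausdorff_weight m (C i \<inter> B))"
      using C by (intro add_mono hausdorff_content_le bd') (auto simp: hausdorff_covers_def)
    also have "\<dots> = (\<Sum>i. hausdorff_weight m (C i \<inter> A) + hausdorff_weight m (C i \<inter> B))"
      by (intro suminf_add) auto
    also have "\<dots> \<le> (\<Sum>i. hausdorff_weight m (C i))"
    proof (intro suminf_le)
      fix i
      have "C i \<inter> A = {} \<or> C i \<inter> B = {}"
      proof (rule ccontr)
        assume "\<not> ?thesis"
        then obtain x y where "x \<in> C i" "x \<in> A" "y \<in> C i" "y \<in> B" by auto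
        with diameter_bounded_bound[OF bd(1), of x i y] bd(2)[of i] sep[of x y] \<delta>
        show False by simp
      qed
      then show "hausdorff_weight m (C i \<inter> A) + hausdorff_weight m (C i \<inter> B)
          \<le> hausdorff_weight m (C i)"
        using hausdorff_weight_mono[OF Int_lower1 bd(1)]
        by (auto simp: hausdorff_weight_def[of m "{}"])
    qed auto
    finally show "hausdorff_content m \<delta> A + hausdorff_content m \<delta> B
        \<le> (\<Sum>i. hausdorff_weight m (C i))" .
  qed
  have eq: "hausdorff_outer_measure m X = (SUP \<delta>\<in>{0<..<r}. hausdorff_content m \<delta> X)" for X :: "'a set"
    unfolding hausdorff_outer_measure_def
  proof (rule antisym[OF SUP_mono SUP_subset_mono])
    fix \<delta> :: real assume "\<delta> \<in> {0<..}"
    then show "\<exists>\<epsilon>\<in>{0<..<r}. hausdorff_content m \<delta> X \<le> hausdorff_content m \<epsilon> X"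
      using r by (intro bexI[of _ "min \<delta> (r / 2)"] hausdorff_content_antimono) auto
  qed auto
  have "hausdorff_outer_measure m A + hausdorff_outer_measure m B
      = (SUP \<delta>\<in>{0<..<r}. hausdorff_content m \<delta> A + hausdorff_content m \<delta> B)"
    unfolding eq
  proof (rule SUP_add_directed_ennreal[symmetric])
    fix i j assume "i \<in> {0<..<r}" "j \<in> {0<..<r}"
    then show "\<exists>k\<in>{0<..<r}. hausdorff_content m i A + hausdorff_content m j B
        \<le> hausdorff_content m k A + hausdorff_content m k B"
      by (intro bexI[of _ "min i j"] add_mono hausdorff_content_antimono) auto
  qed
  also have "\<dots> \<le> hausdorff_outer_measure m (A \<union> B)"
    unfolding eq by (intro SUP_mono) (use * in force)
  finally show ?thesis .
qed

text \<open>Caratheodory's criterion.\<close>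

lemma hausdorff_outer_measure_closed_split:
  fixes C :: "'a::metric_space set"
  assumes "closed C"
  shows "hausdorff_outer_measure m (A \<inter> C) + hausdorff_outer_measure m (A - C)
      \<le> hausdorff_outer_measure m A"
proof (cases "C = {} \<or> hausdorff_outer_measure m A = top")
  case True
  then show ?thesis by auto
next
  case False
  let ?H = "hausdorff_outer_measure m :: 'a set \<Rightarrow> ennreal"
  from False have ne: "C \<noteq> {}" and fin: "?H A < top"
    by (auto simp: less_top)
  define a where "a k = {x \<in> A. 1 / real (Suc k) \<le> infdist x C}" for k
  define R where "R k = {x \<in> A. 1 / real (Suc (Suc k)) \<le> infdist x C \<and> infdist x C < 1 / real (Suc k)}" for k
  have pos: "0 < infdist x C" if "x \<notin> C" for x
    using that assms ne by (metis in_closed_iff_infdist_zero infdist_nonneg less_le)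
  have dist_ge: "infdist x C - infdist y C \<le> dist x y" for x y
    using infdist_triangle[of x C y] by simp
  have step: "?H (A \<inter> C) + ?H (a k) \<le> ?H A" for k
  proof -
    have "?H (A \<inter> C) + ?H (a k) \<le> ?H (A \<inter> C \<union> a k)"
    proof (rule hausdorff_outer_measure_separated)
      fix x y assume "x \<in> A \<inter> C" "y \<in> a k"
      then show "1 / real (Suc k) \<le> dist x y"
        using dist_ge[of y x] by (auto simp: a_def dist_commute)
    qed simp
    also have "\<dots> \<le> ?H A"
      by (rule hausdorff_outer_measure_mono) (auto simp: a_def)
    finally show ?thesis .
  qed
  have inv: "1 / real (Suc j) \<le> 1 / real (Suc i)" if "i \<le> j" for i j
    using that by (simp add: field_simps)
  have every2: "(\<Sum>i<n. ?H (R (2 * i + b))) \<le> ?H (\<Union>i<n. R (2 * i + b))" for n b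
  proof (induction n)
    case (Suc n)
    have "?H (\<Union>i<n. R (2 * i + b)) + ?H (R (2 * n + b + 0))
        \<le> ?H ((\<Union>i<n. R (2 * i + b)) \<union> R (2 * n + b + 0))"
    proof (cases "n = 0")
      case False
      show ?thesis
      proof (rule hausdorff_outer_measure_separated)
        show "0 < 1 / real (2 * n + b) - 1 / real (Suc (2 * n + b))"
          using False by (simp add: frac_less2)
        fix x y assume "x \<in> (\<Union>i<n. R (2 * i + b))" and y: "y \<in> R (2 * n + b + 0)"
        then obtain i where i: "i < n" "x \<in> R (2 * i + b)" by auto
        obtain p where p: "2 * n + b = Suc p" using False by (cases "2 * n + b") auto
        have "1 / real (2 * n + b) \<le> 1 / real (Suc (Suc (2 * i + b)))"
          using inv[of "Suc (2 * i + b)" p] i p by auto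
        then show "1 / real (2 * n + b) - 1 / real (Suc (2 * n + b)) \<le> dist x y"
          using dist_ge[of x y] i y by (auto simp: R_def)
      qed
    qed simp
    with Suc.IH show ?case
      by (auto simp: lessThan_Suc Un_commute add.commute intro: order_trans add_mono)
  qed simp
  have half: "(\<Sum>i. ?H (R (2 * i + b))) \<le> ?H A" for b
  proof (rule suminf_le_const)
    fix n
    show "(\<Sum>i<n. ?H (R (2 * i + b))) \<le> ?H A"
      by (rule order_trans[OF every2 hausdorff_outer_measure_mono]) (auto simp: R_def)
  qed auto
  have "(\<Sum>i. ?H (R i)) \<le> ?H A + ?H A"
  proof (rule suminf_le_const)
    fix n
    have "(\<Sum>i<n. ?H (R i)) \<le> (\<Sum>i<2 * n. ?H (R i))"
      by (intro sum_mono2) auto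
    also have "\<dots> = (\<Sum>i<n. ?H (R (2 * i + 0))) + (\<Sum>i<n. ?H (R (2 * i + 1)))"
      by (induction n) (auto simp: algebra_simps)
    also have "\<dots> \<le> ?H A + ?H A"
      by (intro add_mono order_trans[OF sum_le_suminf half]) auto
    finally show "(\<Sum>i<n. ?H (R i)) \<le> ?H A + ?H A" .
  qed auto
  then have finR: "(\<Sum>i. ?H (R i)) \<noteq> top"
    using fin by (auto simp: top_unique)
  have tail: "(\<lambda>k. \<Sum>i. ?H (R (i + k))) \<longlonglongrightarrow> 0"
  proof -
    have nt: "?H (R i) \<noteq> top" for i
      using finR ennreal_suminf_lessD[of "\<lambda>i. ?H (R i)" top i] by (auto simp: less_top)
    define f where "f i = enn2real (?H (R i))" for i
    have f: "?H (R i) = ennreal (f i)" "0 \<le> f i" for i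
      using nt[of i] by (auto simp: f_def less_top)
    have sf: "summable f"
      using finR f by (intro summable_suminf_not_top) auto
    have "(\<Sum>i. ?H (R (i + k))) = ennreal (\<Sum>i. f (i + k))" for k
      using f sf by (subst f(1)) (intro suminf_ennreal2 summable_ignore_initial_segment; simp)
    moreover have "(\<lambda>k. \<Sum>i. f (i + k)) \<longlonglongrightarrow> 0"
      by (rule suminf_exist_split2[OF sf])
    ultimately show ?thesis
      using tendsto_ennrealI by fastforce
  qed
  have "?H (A \<inter> C) + ?H (A - C) \<le> ?H A + (\<Sum>i. ?H (R (i + k)))" for k
  proof -
    have "A - C \<subseteq> a k \<union> (\<Union>i. R (i + k))"
    proof
      fix x assume x: "x \<in> A - C"
      then obtain N where N: "1 / real (Suc N) < infdist x C"
        using pos[of x] nat_approx_posE[of "infdist x C"] by auto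
      show "x \<in> a k \<union> (\<Union>i. R (i + k))"
      proof (cases "x \<in> a k")
        case False
        define P where "P j \<longleftrightarrow> 1 / real (Suc (j + k)) \<le> infdist x C" for j
        have "P N"
          using N inv[of N "N + k"] by (auto simp: P_def)
        moreover have "\<not> P 0"
          using False x by (auto simp: P_def a_def)
        ultimately obtain j where "\<not> P j" "P (Suc j)"
          using nat_induct[of "\<lambda>j. \<not> P j" N] by blast
        then have "x \<in> R (j + k)"
          using x by (auto simp: P_def R_def)
        then show ?thesis by blast
      qed simp
    qed
    then have "?H (A - C) \<le> ?H (a k \<union> (\<Union>i. R (i + k)))"
      by (rule hausdorff_outer_measure_mono)
    also have "\<dots> \<le> ?H (a k) + (\<Sum>i. ?H (R (i + k)))"
      by (rule order_trans[OF hausdorff_outer_measure_Un])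
         (intro add_mono order_refl hausdorff_outer_measure_UN)
    finally have "?H (A \<inter> C) + ?H (A - C) \<le> ?H (A \<inter> C) + (?H (a k) + (\<Sum>i. ?H (R (i + k))))"
      by (rule add_left_mono)
    also have "\<dots> \<le> ?H A + (\<Sum>i. ?H (R (i + k)))"
      using add_right_mono[OF step[of k]] by (simp add: add.assoc)
    finally show ?thesis .
  qed
  moreover have "(\<lambda>k. ?H A + (\<Sum>i. ?H (R (i + k)))) \<longlonglongrightarrow> ?H A + 0"
    by (intro tendsto_add tail tendsto_const)
  ultimately show ?thesis
    by (intro LIMSEQ_le_const[of _ "?H A"]) auto
qed

lemma measure_space_hausdorff:
  "measure_space (UNIV :: 'a::metric_space set) (sets borel) (hausdorff_outer_measure m)"
proof -
  let ?L = "lambda_system UNIV UNIV (hausdorff_outer_measure m :: 'a set \<Rightarrow> ennreal)"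
  interpret P: sigma_algebra "UNIV :: 'a set" UNIV
    using sigma_algebra_Pow[of "UNIV :: 'a set"] by simp
  have L: "measure_space UNIV ?L (hausdorff_outer_measure m)"
    by (intro P.caratheodory_lemma outer_measure_space_hausdorff)
  then have alg: "sigma_algebra UNIV ?L"
    by (simp add: measure_space_def)
  have "{S. closed S} \<subseteq> ?L"
  proof safe
    fix C :: "'a set" assume "closed C"
    have "hausdorff_outer_measure m (C \<inter> A) + hausdorff_outer_measure m (A - C)
        = hausdorff_outer_measure m A" for A
    proof (rule antisym)
      have "(A \<inter> C) \<union> (A - C) = A" by auto
      then show "hausdorff_outer_measure m A
          \<le> hausdorff_outer_measure m (C \<inter> A) + hausdorff_outer_measure m (A - C)"
        using hausdorff_outer_measure_Un[of m "A \<inter> C" "A - C"] by (simp add: Int_commute)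
      show "hausdorff_outer_measure m (C \<inter> A) + hausdorff_outer_measure m (A - C)
          \<le> hausdorff_outer_measure m A"
        using hausdorff_outer_measure_closed_split[OF \<open>closed C\<close>, of m A]
        by (simp add: Int_commute)
    qed
    then show "C \<in> ?L"
      by (simp add: P.lambda_system_eq Int_commute)
  qed
  then have "sets borel \<subseteq> ?L"
    by (simp add: borel_eq_closed sigma_algebra.sigma_sets_subset[OF alg])
  moreover have "sigma_algebra (UNIV :: 'a set) (sets borel)"
    using sets.sigma_algebra_axioms[of "borel :: 'a measure"] by simp
  ultimately show ?thesis
    using L measure_down by blast
qed

lemma sets_hausdorff_measure [simp]: "sets (hausdorff_measure m) = sets borel"
  and space_hausdorff_measure [simp]: "space (hausdorff_measure m) = UNIV"
  using sets.sigma_sets_eq[of "borel :: 'a measure"]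
  by (simp_all add: hausdorff_measure_def space_measure_of_conv sets_measure_of)

lemma emeasure_hausdorff_measure:
  fixes A :: "'a::metric_space set"
  assumes "A \<in> sets borel"
  shows "emeasure (hausdorff_measure m) A = hausdorff_outer_measure m A"
  unfolding hausdorff_measure_def
  using measure_space_hausdorff[where 'a = 'a, of m] assms
  by (intro emeasure_measure_of_sigma) (auto simp: measure_space_def)

definition spherical_measure :: "'a::euclidean_space measure" where
  "spherical_measure = restrict_space (hausdorff_measure (DIM('a) - 1)) (sphere 0 1)"


section \<open>Convex bodies\<close>

definition convex_bodies_o :: "'a::euclidean_space set set" where
  "convex_bodies_o = {K. compact K \<and> convex K \<and> 0 \<in> interior K}"

text \<open>For \<open>K\<close> in \<^const>\<open>convex_bodies_o\<close> the suprema below are attained.\<close>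

definition support_function :: "'a::euclidean_space set \<Rightarrow> 'a \<Rightarrow> real" where
  "support_function K u = (SUP x\<in>K. x \<bullet> u)"

definition radial_function :: "'a::euclidean_space set \<Rightarrow> 'a \<Rightarrow> real" where
  "radial_function K u = Sup {r. 0 \<le> r \<and> r *\<^sub>R u \<in> K}"

definition polar_body :: "'a::euclidean_space set \<Rightarrow> 'a set" where
  "polar_body K = {x. \<forall>y\<in>K. x \<bullet> y \<le> 1}"


section \<open>Orlicz norms and general dual volumes\<close>

text \<open>Functions on \<open>(0,\<infinity>)\<close> are modelled by functions on the reals all of whose properties are
  imposed on \<open>{0<..}\<close> only.\<close>

definition class_I :: "(real \<Rightarrow> real) set" where
  "class_I = {\<phi>. continuous_on {0<..} \<phi> \<and> strict_mono_on {0<..} \<phi> \<and> (\<forall>t>0. 0 < \<phi> t)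
     \<and> (\<phi> \<longlongrightarrow> 0) (at_right 0) \<and> \<phi> 1 = 1 \<and> filterlim \<phi> at_top at_top}"

definition class_G_I :: "(real \<Rightarrow> 'a::euclidean_space \<Rightarrow> real) set" where
  "class_G_I = {G. continuous_on ({0<..} \<times> sphere 0 1) (\<lambda>(t, u). G t u)
     \<and> (\<forall>t>0. \<forall>u\<in>sphere 0 1. 0 < G t u)
     \<and> (\<forall>u\<in>sphere 0 1. strict_mono_on {0<..} (\<lambda>t. G t u)
          \<and> ((\<lambda>t. G t u) \<longlongrightarrow> 0) (at_right 0)
          \<and> filterlim (\<lambda>t. G t u) at_top at_top)}"

definition orlicz_norm ::
  "'a::euclidean_space measure \<Rightarrow> (real \<Rightarrow> real) \<Rightarrow> ('a \<Rightarrow> real) \<Rightarrow> real" where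
  "orlicz_norm \<mu> \<phi> h =
     Inf {r. 0 < r \<and> 1 / measure \<mu> (sphere 0 1) * (\<integral>u. \<phi> (h u / r) \<partial>\<mu>) \<le> 1}"

definition dual_volume ::
  "(real \<Rightarrow> 'a::euclidean_space \<Rightarrow> real) \<Rightarrow> 'a set \<Rightarrow> real" where
  "dual_volume G K = (\<integral>u. G (radial_function K u) u \<partial>spherical_measure)"

definition hom_dual_volume ::
  "(real \<Rightarrow> 'a::euclidean_space \<Rightarrow> real) \<Rightarrow> 'a set \<Rightarrow> real" where
  "hom_dual_volume G K =
     Inf {r. 0 < r \<and> (\<integral>u. G (radial_function K u / r) u \<partial>spherical_measure) \<le> 1}"

definition dual_volume_class ::
  "(real \<Rightarrow> 'a::euclidean_space \<Rightarrow> real) \<Rightarrow> 'a set set" where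
  "dual_volume_class G =
     {Q \<in> convex_bodies_o. dual_volume G (polar_body Q) = dual_volume G (cball 0 1)}"

definition hom_dual_volume_class ::
  "(real \<Rightarrow> 'a::euclidean_space \<Rightarrow> real) \<Rightarrow> 'a set set" where
  "hom_dual_volume_class G =
     {Q \<in> convex_bodies_o. hom_dual_volume G (polar_body Q) = hom_dual_volume G (cball 0 1)}"

definition finite_borel_measure_on_sphere :: "'a::euclidean_space measure \<Rightarrow> bool" where
  "finite_borel_measure_on_sphere \<mu> \<longleftrightarrow>
     sets \<mu> = sets (restrict_space borel (sphere 0 1)) \<and> finite_measure \<mu>"

definition not_concentrated_on_closed_hemisphere :: "'a::euclidean_space measure \<Rightarrow> bool" where
  "not_concentrated_on_closed_hemisphere \<mu> \<longleftrightarrow>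
     (\<forall>v\<in>sphere 0 1. 0 < measure \<mu> {u \<in> sphere 0 1. 0 < u \<bullet> v})"

end

theory Submission
  imports Defs "HOL-Complex_Analysis.Great_Picard"
begin

text \<open>
  Since \<open>1 / h\<^sub>Q\<close> is the radial function of the polar body of \<open>Q\<close>, both the constraint and the
  objective depend only on the support function of \<open>Q\<close>. Along a minimizing sequence the support
  functions are bounded, because \<open>\<mu>\<close> charges caps around all directions uniformly and \<open>\<phi>\<close> is
  unbounded. They are also bounded away from zero: if \<open>h\<close> is \<open>R\<close>-Lipschitz and nearly vanishes at
  \<open>v\<close>, then \<open>1 / h u\<close> is at least of order \<open>1 / \<bar>u - v\<bar>\<close>, and the integral of
  \<open>\<bar>u - v\<bar> powr (1 - n)\<close> over the sphere diverges, which the constraint forbids. Arzela-Ascoli and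
  dominated convergence then give a minimizer.

  For uniqueness, let \<open>H\<close> be the mean of two different minimizing support functions. By convexity of \<open>\<phi>\<close>
  its norm is at most the minimum, while convexity of \<open>G\<close> and the strict inequality between harmonic and
  arithmetic means push the dual volume of its polar body below the prescribed value. Shrinking the body
  restores the constraint and strictly decreases the norm.

  The homogeneous problem is the first one for the weight \<open>G (t / \<eta>) u\<close>, where \<open>\<eta>\<close> is the
  homogeneous dual volume of the ball.
\<close>

section \<open>Hausdorff measure on the sphere\<close>

text \<open>The spherical measure is given by coverings, and its exact values never enter. Three
  estimates carry the argument: it is finite, caps have positive mass, and an annulus between two
  radii of order s has mass at least a constant times s^(n-1). They come from packing and covering
  truncated cones with Euclidean balls.

  The growth exponent n-1 is exactly critical. If \<open>G\<close> grows like t^(n-1), an annulus at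
  distance s from the bad direction contributes an amount independent of s, so each step of a
  geometric sequence of radii adds the same constant. A larger exponent q only helps, because
  t^(n-1) \<le> t^q for t \<ge> 1.

  Limits and means of support functions have to be handled before they are known to be support
  functions. Both functionals are therefore studied on positive continuous functions on the sphere,
  and bodies are built only afterwards: as an intersection of halfspaces for a limit, as a scaled
  Minkowski sum for a mean. The Orlicz norm is an infimum of radii, and upper bounds for it are
  proved by testing every radius strictly above the bound.\<close>

text \<open>Up to constants the spherical measure is compared with the Lebesgue measure of the cone
  over a set, truncated to \<open>1 \<le> norm x \<le> 2\<close>.\<close>

definition cone_measure :: "'a::euclidean_space measure" where
  "cone_measure = distr (restrict_space lborel {x. 1 \<le> norm x \<and> norm x \<le> 2}) borel sgn"

lemma sets_cone_measure [simp]: "sets cone_measure = sets borel"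
  by (simp add: cone_measure_def)

lemma emeasure_cone_measure:
  fixes A :: "'a::euclidean_space set"
  assumes "A \<in> sets borel"
  shows "emeasure cone_measure A = emeasure lborel {x. 1 \<le> norm x \<and> norm x \<le> 2 \<and> sgn x \<in> A}"
proof -
  have eq: "{x::'a. 1 \<le> norm x \<and> norm x \<le> 2} = cball 0 2 - ball 0 1"
    by auto
  then have S: "{x::'a. 1 \<le> norm x \<and> norm x \<le> 2} \<in> sets borel"
    by auto
  have m: "(sgn :: 'a \<Rightarrow> 'a) \<in> borel_measurable borel"
    unfolding sgn_div_norm by measurable
  then have "sgn \<in> restrict_space lborel {x::'a. 1 \<le> norm x \<and> norm x \<le> 2} \<rightarrow>\<^sub>M borel"
    by (intro measurable_restrict_space1) auto
  then have "emeasure cone_measure A = emeasure (restrict_space lborel {x::'a. 1 \<le> norm x \<and> norm x \<le> 2})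
      (sgn -` A \<inter> {x. 1 \<le> norm x \<and> norm x \<le> 2})"
    using assms by (simp add: cone_measure_def emeasure_distr space_restrict_space)
  also have "\<dots> = emeasure lborel (sgn -` A \<inter> {x. 1 \<le> norm x \<and> norm x \<le> 2})"
    using S by (intro emeasure_restrict_space) auto
  also have "sgn -` A \<inter> {x. 1 \<le> norm x \<and> norm x \<le> 2} = {x. 1 \<le> norm x \<and> norm x \<le> 2 \<and> sgn x \<in> A}"
    by auto
  finally show ?thesis .
qed

lemma finite_measure_cone_measure: "finite_measure (cone_measure :: 'a::euclidean_space measure)"
proof (rule finite_measureI)
  have "emeasure (cone_measure :: 'a measure) UNIV \<le> emeasure lborel (cball (0::'a) 2)"
    by (subst emeasure_cone_measure) (auto intro!: emeasure_mono)
  also have "\<dots> < \<infinity>"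
    by (simp add: emeasure_cball)
  finally show "emeasure (cone_measure :: 'a measure) (space cone_measure) \<noteq> \<infinity>"
    by (simp add: cone_measure_def)
qed

lemma measure_cone_measure:
  fixes A :: "'a::euclidean_space set"
  assumes "A \<in> sets borel"
  shows "measure cone_measure A = measure lborel {x. 1 \<le> norm x \<and> norm x \<le> 2 \<and> sgn x \<in> A}"
  using assms by (simp add: emeasure_cone_measure measure_def)

lemma measurable_annulus_cone:
  fixes A :: "'a::euclidean_space set"
  assumes "A \<in> sets borel"
  shows "{x. 1 \<le> norm x \<and> norm x \<le> 2 \<and> sgn x \<in> A} \<in> fmeasurable lborel"
proof (rule fmeasurableI2)
  show "cball (0::'a) 2 \<in> fmeasurable lborel"
    by (intro fmeasurableI) (auto simp: emeasure_cball)
  have m: "(sgn :: 'a \<Rightarrow> 'a) \<in> borel_measurable borel"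
    unfolding sgn_div_norm by measurable
  have "{x::'a. sgn x \<in> A} \<in> sets borel"
    using measurable_sets[OF m assms] by (simp add: vimage_def)
  moreover have "{x. 1 \<le> norm x \<and> norm x \<le> 2 \<and> sgn x \<in> A} = (cball 0 2 - ball 0 1) \<inter> {x::'a. sgn x \<in> A}"
    by auto
  ultimately show "{x::'a. 1 \<le> norm x \<and> norm x \<le> 2 \<and> sgn x \<in> A} \<in> sets lborel"
    by auto
qed auto

text \<open>In \<open>t (sgn x - u) = (t - norm x) sgn x + (x - t u)\<close> both terms on the right
  have norm at most the distance of \<open>x\<close> from \<open>t u\<close>, and dividing by
  \<open>t \<ge> 1\<close> only improves the bound. This places small balls centred on the ray
  through \<open>u\<close> inside the cone over a cap.\<close>

lemma dist_sgn_le: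
  fixes x u :: "'a::real_normed_vector"
  assumes "norm u = 1" "1 \<le> t" "x \<noteq> 0"
  shows "dist u (sgn x) \<le> 2 * dist (t *\<^sub>R u) x"
proof -
  have "t *\<^sub>R (sgn x - u) = (t - norm x) *\<^sub>R sgn x + (x - t *\<^sub>R u)"
    using assms by (simp add: sgn_div_norm algebra_simps)
  then have "norm (t *\<^sub>R (sgn x - u)) \<le> \<bar>t - norm x\<bar> + norm (x - t *\<^sub>R u)"
    using norm_triangle_ineq[of "(t - norm x) *\<^sub>R sgn x" "x - t *\<^sub>R u"] assms by (simp add: norm_sgn)
  also have "\<bar>t - norm x\<bar> \<le> norm (x - t *\<^sub>R u)"
    using norm_triangle_ineq3[of x "t *\<^sub>R u"] assms by simp
  finally have "t * dist u (sgn x) \<le> 2 * dist (t *\<^sub>R u) x"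
    using assms by (simp add: dist_norm norm_minus_commute)
  moreover have "1 * dist u (sgn x) \<le> t * dist u (sgn x)"
    using assms by (intro mult_right_mono) auto
  ultimately show ?thesis by linarith
qed

text \<open>About \<open>1 / s\<close> disjoint balls of radius \<open>s / 2\<close>, lined up along
  the segment from \<open>u\<close> to \<open>2 u\<close>, fit into the truncated cone over the cap.
  Each has volume of order s^n, which leaves s^(n-1).\<close>

lemma cone_measure_cball_ge:
  fixes u :: "'a::euclidean_space"
  assumes u: "u \<in> sphere 0 1" and s: "0 < s" "s \<le> 1"
  shows "unit_ball_vol (real DIM('a)) / (2 * 2 ^ DIM('a)) * s ^ (DIM('a) - 1) \<le> measure cone_measure (cball u s)"
proof -
  define N where "N = nat \<lfloor>1 / s\<rfloor>"
  have N: "real N \<le> 1 / s" "1 / s < real N + 1" "1 \<le> N"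
    using s by (auto simp: N_def le_nat_iff le_floor_iff)
  define B where "B i = ball ((1 + (2 * real i + 1) * (s / 2)) *\<^sub>R u) (s / 2)" for i :: nat
  let ?E = "{x. 1 \<le> norm x \<and> norm x \<le> 2 \<and> sgn x \<in> cball u s}"
  have nu: "norm u = 1" using u by simp
  have sub: "B i \<subseteq> ?E" if "i < N" for i
  proof
    fix x assume x: "x \<in> B i"
    define t where "t = 1 + (2 * real i + 1) * (s / 2)"
    have "real i + 1 \<le> real N" using that by linarith
    then have "(real i + 1) * s \<le> 1"
      using N(1) s by (smt (verit) mult_right_mono nonzero_eq_divide_eq pos_le_divide_eq)
    then have t: "1 + s / 2 \<le> t" "t + s / 2 \<le> 2"
      using s by (auto simp: t_def algebra_simps)
    have d: "dist (t *\<^sub>R u) x < s / 2" using x by (simp add: B_def t_def)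
    then have "\<bar>norm x - t\<bar> < s / 2"
      using norm_triangle_ineq3[of x "t *\<^sub>R u"] nu t s by (simp add: dist_norm norm_minus_commute)
    then have nx: "1 \<le> norm x" "norm x \<le> 2" using t by linarith+
    then have "x \<noteq> 0" by auto
    then have "dist u (sgn x) \<le> s"
      using dist_sgn_le[OF nu, of t x] t d s by simp
    with nx show "x \<in> ?E" by simp
  qed
  have disj: "disjoint_family_on B {..<N}"
  proof (unfold disjoint_family_on_def, intro ballI impI)
    fix i j assume "i \<in> {..<N}" "j \<in> {..<N}" "i \<noteq> j"
    have "dist ((1 + (2 * real i + 1) * (s / 2)) *\<^sub>R u) ((1 + (2 * real j + 1) * (s / 2)) *\<^sub>R u)
        = \<bar>(real i - real j) * s\<bar>"
      unfolding dist_norm scaleR_diff_left[symmetric] norm_scaleR nu mult_1_right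
      by (rule arg_cong[where f = abs]) (simp add: field_simps)
    also have "\<dots> = \<bar>real i - real j\<bar> * s" using s by (simp add: abs_mult)
    also have "1 \<le> \<bar>real i - real j\<bar>" using \<open>i \<noteq> j\<close> by linarith
    then have "1 * s \<le> \<bar>real i - real j\<bar> * s" using s by (intro mult_right_mono) auto
    finally show "B i \<inter> B j = {}"
      unfolding B_def by (intro disjoint_ballI) auto
  qed
  have "real N * (unit_ball_vol (real DIM('a)) * (s / 2) ^ DIM('a)) = (\<Sum>i<N. measure lborel (B i))"
    using s by (simp add: B_def content_ball)
  also have "\<dots> = measure lborel (\<Union>i<N. B i)"
    by (intro measure_finite_Union[symmetric] disj) (auto simp: B_def emeasure_ball s less_imp_le)
  also have "\<dots> \<le> measure lborel ?E"
    using sub by (intro measure_mono_fmeasurable measurable_annulus_cone) (auto simp: B_def)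
  also have "\<dots> = measure cone_measure (cball u s)"
    by (simp add: measure_cone_measure)
  finally have 1: "real N * (unit_ball_vol (real DIM('a)) * (s / 2) ^ DIM('a)) \<le> measure cone_measure (cball u s)" .
  \<comment> \<open>Rounding \<open>1 / s\<close> down loses at most half of it, since
    \<open>N \<ge> 1\<close>. This is the extra factor 2 in the denominator of the bound.\<close>
  have "s * 1 \<le> s * real N" using N s by (intro mult_left_mono) auto
  moreover have "1 < s * real N + s" using N s by (simp add: field_simps)
  ultimately have N2: "1 / 2 \<le> real N * s"
    by (simp add: mult.commute)
  have D: "s ^ DIM('a) = s * s ^ (DIM('a) - 1)"
    using DIM_positive[where 'a='a] by (metis power_eq_if not_gr_zero)
  have "unit_ball_vol (real DIM('a)) / (2 * 2 ^ DIM('a)) * s ^ (DIM('a) - 1)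
      = (1 / 2) * (unit_ball_vol (real DIM('a)) / (2 ^ DIM('a)) * s ^ (DIM('a) - 1))"
    by simp
  also have "\<dots> \<le> (real N * s) * (unit_ball_vol (real DIM('a)) / (2 ^ DIM('a)) * s ^ (DIM('a) - 1))"
    using N2 s by (intro mult_right_mono) auto
  also have "\<dots> = real N * (unit_ball_vol (real DIM('a)) * (s / 2) ^ DIM('a))"
    by (simp add: power_divide D)
  finally show ?thesis using 1 by linarith
qed

text \<open>The truncated cone over the cap is covered by \<open>N + 1\<close> balls centred on the
  ray at spacing \<open>s\<close>. Their radius \<open>3 * s\<close> adds up an angular error of at
  most \<open>2 * s\<close> (norms are at most 2) and a radial rounding error of at most
  \<open>s\<close>.\<close>

lemma cone_measure_cball_le_if_pos:
  fixes u :: "'a::euclidean_space"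
  assumes u: "u \<in> sphere 0 1" and s: "0 < s" "s \<le> 1"
  shows "measure cone_measure (cball u s) \<le> 2 * 3 ^ DIM('a) * unit_ball_vol (real DIM('a)) * s ^ (DIM('a) - 1)"
proof -
  define N where "N = nat \<lfloor>1 / s\<rfloor>"
  have N: "real N \<le> 1 / s" "1 / s < real N + 1"
    using s by (auto simp: N_def)
  define B where "B i = cball ((1 + real i * s) *\<^sub>R u) (3 * s)" for i :: nat
  let ?E = "{x. 1 \<le> norm x \<and> norm x \<le> 2 \<and> sgn x \<in> cball u s}"
  have nu: "norm u = 1" using u by simp
  have sub: "?E \<subseteq> (\<Union>i\<le>N. B i)"
  proof
    fix x assume x: "x \<in> ?E"
    define i where "i = nat \<lfloor>(norm x - 1) / s\<rfloor>"
    have i: "real i \<le> (norm x - 1) / s" "(norm x - 1) / s < real i + 1"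
      using x s by (auto simp: i_def)
    have "(norm x - 1) / s \<le> 1 / s" using x s by (intro divide_right_mono) auto
    then have "i \<le> N" using N i by linarith
    define t where "t = 1 + real i * s"
    have t: "\<bar>norm x - t\<bar> \<le> s" using i s by (simp add: t_def field_simps)
    have "x \<noteq> 0" using x by auto
    then have xe: "x = norm x *\<^sub>R sgn x" by (simp add: sgn_div_norm)
    have "x - t *\<^sub>R u = norm x *\<^sub>R (sgn x - u) + (norm x - t) *\<^sub>R u"
      by (subst (1) xe) (simp add: algebra_simps)
    then have "norm (x - t *\<^sub>R u) \<le> norm x * norm (sgn x - u) + \<bar>norm x - t\<bar>"
      using norm_triangle_ineq[of "norm x *\<^sub>R (sgn x - u)" "(norm x - t) *\<^sub>R u"] nu by simp
    also have "norm x * norm (sgn x - u) \<le> 2 * s"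
      using x s by (intro mult_mono) (auto simp: dist_norm norm_minus_commute)
    finally have "x \<in> B i" using t by (simp add: B_def dist_norm norm_minus_commute t_def)
    with \<open>i \<le> N\<close> show "x \<in> (\<Union>i\<le>N. B i)" by auto
  qed
  have "measure cone_measure (cball u s) = measure lborel ?E"
    by (simp add: measure_cone_measure)
  also have "\<dots> \<le> measure lborel (\<Union>i\<le>N. B i)"
    using sub measurable_annulus_cone[of "cball u s"]
    by (intro measure_mono_fmeasurable fmeasurable.finite_UN)
       (auto simp: B_def emeasure_cball s less_imp_le intro!: fmeasurableI)
  also have "\<dots> \<le> (\<Sum>i\<le>N. measure lborel (B i))"
    by (intro measure_UNION_le) (auto simp: B_def emeasure_cball s less_imp_le intro!: fmeasurableI)
  also have "\<dots> = (real N + 1) * (unit_ball_vol (real DIM('a)) * (3 * s) ^ DIM('a))"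
    using s by (simp add: B_def content_cball)
  finally have le: "measure cone_measure (cball u s)
      \<le> (real N + 1) * (unit_ball_vol (real DIM('a)) * (3 * s) ^ DIM('a))" .
  have D: "s ^ DIM('a) = s * s ^ (DIM('a) - 1)"
    using DIM_positive[where 'a='a] by (metis power_eq_if not_gr_zero)
  have N2: "(real N + 1) * s \<le> 2" using N s by (simp add: field_simps)
  have "(real N + 1) * (unit_ball_vol (real DIM('a)) * (3 * s) ^ DIM('a))
     = ((real N + 1) * s) * (3 ^ DIM('a) * unit_ball_vol (real DIM('a)) * s ^ (DIM('a) - 1))"
    by (simp add: power_mult_distrib D)
  also have "\<dots> \<le> 2 * (3 ^ DIM('a) * unit_ball_vol (real DIM('a)) * s ^ (DIM('a) - 1))"
    using N2 s by (intro mult_right_mono) auto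
  finally show ?thesis using le by (simp only: mult.assoc)
qed

text \<open>Radius zero is included because a set in a Hausdorff covering may be a single point.
  There the bound follows by shrinking the radius, and the right-hand side vanishes because the
  exponent is positive.\<close>

lemma cone_measure_cball_le:
  fixes u :: "'a::euclidean_space"
  assumes D: "2 \<le> DIM('a)" and u: "u \<in> sphere 0 1" and s: "0 \<le> s" "s \<le> 1"
  shows "measure cone_measure (cball u s) \<le> 2 * 3 ^ DIM('a) * unit_ball_vol (real DIM('a)) * s ^ (DIM('a) - 1)"
proof (cases "s = 0")
  case False
  with assms show ?thesis by (intro cone_measure_cball_le_if_pos) auto
next
  case True
  let ?K = "2 * 3 ^ DIM('a) * unit_ball_vol (real DIM('a))"
  have K: "0 < ?K" by simp
  interpret finite_measure "cone_measure :: 'a measure" by (rule finite_measure_cone_measure)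
  have "measure cone_measure (cball u 0) \<le> 0 + e" if "0 < e" for e
  proof -
    define t where "t = min 1 (e / ?K)"
    have t: "0 < t" "t \<le> 1" "t \<le> e / ?K" using that K by (auto simp: t_def)
    have "measure cone_measure (cball u 0) \<le> measure cone_measure (cball u t)"
      using t by (intro finite_measure_mono) auto
    also have "\<dots> \<le> ?K * t ^ (DIM('a) - 1)"
      using u t(1,2) by (rule cone_measure_cball_le_if_pos)
    also have "\<dots> \<le> ?K * t"
      using t D K power_decreasing[of 1 "DIM('a) - 1" t] by (intro mult_left_mono) auto
    also have "\<dots> \<le> e" using t(3) K by (simp add: pos_le_divide_eq mult.commute)
    finally show ?thesis by simp
  qed
  then have "measure cone_measure (cball u 0) \<le> 0"
    by (rule field_le_epsilon)
  with True D show ?thesis by (simp add: power_0_left)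
qed

text \<open>Mass distribution principle: the upper regularity of the cone measure gives a lower bound for
  the Hausdorff measure.\<close>

lemma hausdorff_outer_measure_ge_cone_measure:
  assumes D: "2 \<le> DIM('a::euclidean_space)"
  shows "\<exists>c>0. \<forall>A\<in>sets (borel :: 'a measure). A \<subseteq> sphere 0 1 \<longrightarrow>
    ennreal c * emeasure cone_measure A \<le> hausdorff_outer_measure (DIM('a) - 1) A"
proof -
  define m where "m = DIM('a) - 1"
  define K where "K = 2 * 3 ^ DIM('a) * unit_ball_vol (real DIM('a))"
  \<comment> \<open>With this value \<open>c * K * d ^ m\<close> is exactly the Hausdorff weight of
    a nonempty set of diameter \<open>d\<close>.\<close>
  define c where "c = unit_ball_vol (real m) / (K * 2 ^ m)"
  have K: "0 < K" by (simp add: K_def)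
  have c: "0 < c" using K by (simp add: c_def)
  interpret finite_measure "cone_measure :: 'a measure" by (rule finite_measure_cone_measure)
  have "ennreal c * emeasure cone_measure A \<le> hausdorff_outer_measure m A"
    if A: "A \<in> sets borel" "A \<subseteq> sphere 0 1" for A :: "'a set"
  proof -
    \<comment> \<open>Scale 1 suffices, because the outer measure is a supremum over scales; it also
      keeps the diameters in the range where the cap bound holds.\<close>
    have "ennreal c * emeasure cone_measure A \<le> hausdorff_content m 1 A"
      unfolding hausdorff_content_def
    proof (rule INF_greatest)
      fix C assume "C \<in> hausdorff_covers 1 A"
      then have C: "A \<subseteq> (\<Union>i. C i)" "\<And>i. bounded (C i)" "\<And>i. diameter (C i) \<le> 1"
        by (auto simp: hausdorff_covers_def)
      \<comment> \<open>The covering sets need not be Borel. Each one that meets \<open>A\<close> is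
        enlarged to a closed ball about a point of \<open>A\<close>, with the diameter of the set as
        radius.\<close>
      have "\<exists>U\<in>sets borel. C i \<inter> A \<subseteq> U \<and> ennreal c * emeasure cone_measure U \<le> hausdorff_weight m (C i)" for i
      proof (cases "C i \<inter> A = {}")
        case True
        then show ?thesis by (intro bexI[of _ "{}"]) auto
      next
        case False
        then obtain u where u: "u \<in> C i" "u \<in> sphere 0 1" using A by blast
        let ?d = "diameter (C i)"
        have d: "0 \<le> ?d" "?d \<le> 1" using diameter_ge_0[OF C(2)] C(3) by auto
        have "c * measure cone_measure (cball u ?d) \<le> c * (K * ?d ^ m)"
          using cone_measure_cball_le[OF D u(2) d] c
          by (intro mult_left_mono) (auto simp: K_def m_def)
        also have "\<dots> = unit_ball_vol (real m) * (?d / 2) ^ m"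
          using K by (simp add: c_def power_divide)
        finally have "ennreal c * emeasure cone_measure (cball u ?d) \<le> hausdorff_weight m (C i)"
          using c u by (auto simp: hausdorff_weight_def emeasure_eq_measure ennreal_mult'[symmetric] intro!: ennreal_leI)
        moreover have "C i \<subseteq> cball u ?d"
          using diameter_bounded_bound[OF C(2) u(1)] by auto
        ultimately show ?thesis by (intro bexI[of _ "cball u ?d"]) auto
      qed
      then obtain U where U: "\<And>i. U i \<in> sets borel" "\<And>i. C i \<inter> A \<subseteq> U i"
        "\<And>i. ennreal c * emeasure cone_measure (U i) \<le> hausdorff_weight m (C i)"
        by metis
      have "emeasure cone_measure A \<le> emeasure cone_measure (\<Union>i. U i)"
        using C(1) U(1,2) by (intro emeasure_mono) (auto, blast)
      also have "\<dots> \<le> (\<Sum>i. emeasure cone_measure (U i))"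
        using U(1) by (intro emeasure_subadditive_countably) auto
      finally have "ennreal c * emeasure cone_measure A \<le> ennreal c * (\<Sum>i. emeasure cone_measure (U i))"
        by (rule mult_left_mono) simp
      also have "\<dots> = (\<Sum>i. ennreal c * emeasure cone_measure (U i))"
        by simp
      also have "\<dots> \<le> (\<Sum>i. hausdorff_weight m (C i))"
        using U(3) by (intro suminf_le) auto
      finally show "ennreal c * emeasure cone_measure A \<le> (\<Sum>i. hausdorff_weight m (C i))" .
    qed
    also have "\<dots> \<le> hausdorff_outer_measure m A"
      unfolding hausdorff_outer_measure_def by (rule SUP_upper) simp
    finally show ?thesis .
  qed
  with c show ?thesis by (auto simp: m_def)
qed

text \<open>Take a maximal set of points of the sphere at mutual distance more than
  \<open>s\<close>. The balls of radius \<open>s / 2\<close> about them are disjoint and each has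
  cone measure at least the constant in the statement, which bounds the number of points. By
  maximality the balls of radius \<open>s\<close> cover.\<close>

lemma sphere_cover_cballs:
  assumes s: "0 < s" "s \<le> 1"
  shows "\<exists>F \<subseteq> sphere (0::'a::euclidean_space) 1. finite F \<and> sphere 0 1 \<subseteq> (\<Union>p\<in>F. cball p s) \<and>
    real (card F) * (unit_ball_vol (real DIM('a)) / (2 * 2 ^ DIM('a)) * (s / 2) ^ (DIM('a) - 1))
      \<le> measure (cone_measure :: 'a measure) UNIV"
proof -
  let ?k = "unit_ball_vol (real DIM('a)) / (2 * 2 ^ DIM('a)) * (s / 2) ^ (DIM('a) - 1)"
  let ?\<nu> = "cone_measure :: 'a measure"
  interpret finite_measure ?\<nu> by (rule finite_measure_cone_measure)
  define P where "P F \<longleftrightarrow> F \<subseteq> sphere (0::'a) 1 \<and> finite F \<and> pairwise (\<lambda>x y. s < dist x y) F" for F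
  have k: "0 < ?k" using s by simp
  have bound: "real (card F) * ?k \<le> measure ?\<nu> UNIV" if "P F" for F
  proof -
    have F: "F \<subseteq> sphere 0 1" "finite F" "pairwise (\<lambda>x y. s < dist x y) F" using that by (auto simp: P_def)
    have "disjoint_family_on (\<lambda>p. cball p (s / 2)) F"
      unfolding disjoint_family_on_def
    proof (intro ballI impI)
      fix p q assume "p \<in> F" "q \<in> F" "p \<noteq> q"
      then have "s < dist p q" using F(3) by (auto simp: pairwise_def)
      then show "cball p (s / 2) \<inter> cball q (s / 2) = {}" by (intro disjoint_cballI) auto
    qed
    then have "(\<Sum>p\<in>F. measure ?\<nu> (cball p (s / 2))) = measure ?\<nu> (\<Union>p\<in>F. cball p (s / 2))"
      using F by (intro finite_measure_finite_Union[symmetric]) auto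
    also have "\<dots> \<le> measure ?\<nu> UNIV"
      by (intro finite_measure_mono) auto
    finally have "(\<Sum>p\<in>F. measure ?\<nu> (cball p (s / 2))) \<le> measure ?\<nu> UNIV" .
    moreover have "(\<Sum>p\<in>F. ?k) \<le> (\<Sum>p\<in>F. measure ?\<nu> (cball p (s / 2)))"
      using F s by (intro sum_mono cone_measure_cball_ge) auto
    ultimately show ?thesis by simp
  qed
  obtain b where b: "measure ?\<nu> UNIV / ?k < real b"
    using reals_Archimedean2 by blast
  have cb: "card F < b" if "P F" for F
  proof -
    have "real (card F) \<le> measure ?\<nu> UNIV / ?k"
      using bound[OF that] k by (simp only: pos_le_divide_eq)
    with b have "real (card F) < real b" by (rule order.strict_trans1[rotated])
    then show ?thesis by simp
  qed
  have "P {}" by (simp add: P_def)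
  then obtain F where F: "P F" "\<And>F'. P F' \<Longrightarrow> card F' \<le> card F"
    using ex_has_greatest_nat[of P "{}" card b] cb less_imp_le by metis
  have "sphere 0 1 \<subseteq> (\<Union>p\<in>F. cball p s)"
  proof (rule ccontr)
    assume "\<not> ?thesis"
    then obtain x where x: "x \<in> sphere 0 1" "x \<notin> (\<Union>p\<in>F. cball p s)"
      by blast
    then have x: "x \<in> sphere 0 1" "\<And>p. p \<in> F \<Longrightarrow> s < dist p x"
      by (auto simp: not_le)
    have "x \<notin> F" using x(2)[of x] s by auto
    moreover have "P (insert x F)"
      using F(1) x by (auto simp: P_def pairwise_insert dist_commute)
    ultimately show False using F(2)[of "insert x F"] F(1) by (simp add: P_def)
  qed
  with F(1) bound[OF F(1)] show ?thesis by (auto simp: P_def)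
qed

text \<open>The number of covering balls of radius \<open>s\<close> is of order s^(-m) and each has
  weight of order s^m, so the total weight is bounded independently of the scale.\<close>

lemma hausdorff_outer_measure_sphere_finite:
  "hausdorff_outer_measure (DIM('a) - 1) (sphere (0::'a::euclidean_space) 1) < top"
proof -
  define m where "m = DIM('a) - 1"
  define k where "k = unit_ball_vol (real DIM('a)) / (2 * 2 ^ DIM('a))"
  define V where "V = measure (cone_measure :: 'a measure) UNIV"
  have k: "0 < k" by (simp add: k_def)
  have "hausdorff_outer_measure m (sphere (0::'a) 1) \<le> ennreal (V * 2 ^ m / k * unit_ball_vol (real m))"
    unfolding hausdorff_outer_measure_def
  proof (rule SUP_least)
    fix \<delta> :: real assume "\<delta> \<in> {0<..}"
    define s where "s = min 1 (\<delta> / 2)"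
    have s: "0 < s" "s \<le> 1" "2 * s \<le> \<delta>" using \<open>\<delta> \<in> _\<close> by (auto simp: s_def)
    obtain F where F: "F \<subseteq> sphere (0::'a) 1" "finite F" "sphere 0 1 \<subseteq> (\<Union>p\<in>F. cball p s)"
      "real (card F) * (k * (s / 2) ^ m) \<le> V"
      using sphere_cover_cballs[OF s(1,2), where 'a='a] unfolding k_def m_def V_def by blast
    obtain g :: "nat \<Rightarrow> 'a" where g: "F = g ` {..<card F}"
      using F(2) by (metis ex_bij_betw_nat_finite bij_betw_imp_surj_on lessThan_atLeast0)
    \<comment> \<open>The finite cover is padded to a sequence by empty sets, which have weight 0
      even for \<open>m = 0\<close>.\<close>
    define C where "C i = (if i < card F then cball (g i) s else {})" for i
    have w: "hausdorff_weight m (cball (g i) s) = ennreal (unit_ball_vol (real m) * s ^ m)" for i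
      using s by (simp add: hausdorff_weight_def)
    have "hausdorff_content m \<delta> (sphere (0::'a) 1) \<le> (\<Sum>i. hausdorff_weight m (C i))"
    proof (rule hausdorff_content_le)
      show "sphere 0 1 \<subseteq> (\<Union>i. C i)"
      proof
        fix x :: 'a assume "x \<in> sphere 0 1"
        then obtain p where "p \<in> F" "x \<in> cball p s" using F(3) by auto
        then obtain i where "i < card F" "x \<in> cball (g i) s" using g by (metis imageE lessThan_iff)
        then show "x \<in> (\<Union>i. C i)" by (auto simp: C_def intro!: exI[of _ i])
      qed
      show "bounded (C i)" "diameter (C i) \<le> \<delta>" for i
        using s \<open>\<delta> \<in> _\<close> by (auto simp: C_def)
    qed
    also have "\<dots> = (\<Sum>i<card F. hausdorff_weight m (C i))"
      by (intro suminf_finite) (auto simp: C_def hausdorff_weight_def)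
    also have "\<dots> = of_nat (card F) * ennreal (unit_ball_vol (real m) * s ^ m)"
      by (simp add: C_def w)
    also have "\<dots> = ennreal (real (card F) * (unit_ball_vol (real m) * s ^ m))"
      by (simp add: ennreal_mult' ennreal_of_nat_eq_real_of_nat)
    also have "\<dots> \<le> ennreal (V * 2 ^ m / k * unit_ball_vol (real m))"
    proof (rule ennreal_leI)
      have "real (card F) * s ^ m \<le> V * 2 ^ m / k"
        using F(4) k by (simp add: power_divide field_simps)
      then have "real (card F) * s ^ m * unit_ball_vol (real m) \<le> V * 2 ^ m / k * unit_ball_vol (real m)"
        by (rule mult_right_mono) simp
      then show "real (card F) * (unit_ball_vol (real m) * s ^ m) \<le> V * 2 ^ m / k * unit_ball_vol (real m)"
        by (simp add: mult_ac)
    qed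
    finally show "hausdorff_content m \<delta> (sphere (0::'a) 1) \<le> ennreal (V * 2 ^ m / k * unit_ball_vol (real m))" .
  qed
  then show ?thesis
    by (simp add: m_def) (metis ennreal_less_top le_less_trans)
qed

section \<open>Finiteness of the spherical measure and lower bounds on annuli and caps\<close>

lemma sets_spherical_measure: "sets (spherical_measure :: 'a::euclidean_space measure) = sets (restrict_space borel (sphere 0 1))"
  unfolding spherical_measure_def by (intro sets_restrict_space_cong) simp

lemma emeasure_spherical_measure:
  fixes A :: "'a::euclidean_space set"
  assumes "A \<in> sets borel" "A \<subseteq> sphere 0 1"
  shows "emeasure spherical_measure A = hausdorff_outer_measure (DIM('a) - 1) A"
  unfolding spherical_measure_def using assms
  by (subst emeasure_restrict_space) (auto simp: emeasure_hausdorff_measure)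

lemma finite_borel_measure_spherical_measure:
  "finite_borel_measure_on_sphere (spherical_measure :: 'a::euclidean_space measure)"
  unfolding finite_borel_measure_on_sphere_def
proof (intro conjI sets_spherical_measure finite_measureI)
  have "space (spherical_measure :: 'a measure) = sphere 0 1"
    by (simp add: spherical_measure_def space_restrict_space)
  then show "emeasure (spherical_measure :: 'a measure) (space spherical_measure) \<noteq> \<infinity>"
    using hausdorff_outer_measure_sphere_finite[where 'a='a]
    by (simp add: emeasure_spherical_measure)
qed

text \<open>The cone measure of a cap of radius \<open>s\<close> lies between
  \<open>k * s ^ m\<close> and \<open>K * s ^ m\<close>. For small \<open>\<theta>\<close> the inner
  cap therefore takes away at most half of the outer one, and the comparison with the Hausdorff
  measure transfers what remains.\<close>

lemma spherical_measure_annulus_ge: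
  assumes D: "2 \<le> DIM('a::euclidean_space)"
  shows "\<exists>\<theta> c. 0 < \<theta> \<and> \<theta> < 1 \<and> 0 < c \<and> (\<forall>v\<in>sphere (0::'a) 1. \<forall>s. 0 < s \<and> s \<le> 1 \<longrightarrow>
    c * s ^ (DIM('a) - 1) \<le> measure spherical_measure {u \<in> sphere 0 1. \<theta> * s < dist v u \<and> dist v u \<le> s})"
proof -
  define m where "m = DIM('a) - 1"
  have m: "1 \<le> m" using D by (simp add: m_def)
  define k where "k = unit_ball_vol (real DIM('a)) / (2 * 2 ^ DIM('a))"
  define K where "K = 2 * 3 ^ DIM('a) * unit_ball_vol (real DIM('a))"
  \<comment> \<open>Since \<open>m \<ge> 1\<close>, this choice gives
    \<open>K * \<theta> ^ m \<le> K * \<theta> \<le> k / 2\<close>.\<close>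
  define \<theta> where "\<theta> = min (1 / 2) (k / (2 * K))"
  have pos: "0 < k" "0 < K" by (auto simp: k_def K_def)
  have \<theta>: "0 < \<theta>" "\<theta> < 1" "\<theta> \<le> k / (2 * K)" using pos by (auto simp: \<theta>_def)
  obtain c where c: "0 < c" and ge: "\<And>A::'a set. A \<in> sets borel \<Longrightarrow> A \<subseteq> sphere 0 1 \<Longrightarrow>
      ennreal c * emeasure cone_measure A \<le> hausdorff_outer_measure m A"
    using hausdorff_outer_measure_ge_cone_measure[OF D] unfolding m_def by blast
  interpret N: finite_measure "cone_measure :: 'a measure" by (rule finite_measure_cone_measure)
  interpret S: finite_measure "spherical_measure :: 'a measure"
    using finite_borel_measure_spherical_measure by (auto simp: finite_borel_measure_on_sphere_def)
  have "(c * k / 2) * s ^ m \<le> measure spherical_measure {u \<in> sphere 0 1. \<theta> * s < dist v u \<and> dist v u \<le> s}"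
    if v: "v \<in> sphere 0 1" and s: "0 < s" "s \<le> 1" for v :: 'a and s
  proof -
    have \<theta>s: "0 \<le> \<theta> * s" "\<theta> * s \<le> 1" "\<theta> * s \<le> s" using \<theta> s by (auto simp: mult_le_one)
    let ?A = "{u \<in> sphere 0 1. \<theta> * s < dist v u \<and> dist v u \<le> s}"
    have A: "?A = (cball v s - cball v (\<theta> * s)) \<inter> sphere 0 1" by auto
    have Ab: "?A \<in> sets borel" unfolding A by auto
    have "\<theta> ^ m \<le> \<theta>" using power_decreasing[of 1 m \<theta>] m \<theta> by auto
    also have "\<dots> \<le> k / (2 * K)" by (rule \<theta>)
    finally have "K * \<theta> ^ m \<le> k / 2" using pos by (simp add: field_simps)
    then have "K * \<theta> ^ m * s ^ m \<le> k / 2 * s ^ m" using s by (intro mult_right_mono) auto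
    moreover have "measure cone_measure (cball v (\<theta> * s)) \<le> K * (\<theta> * s) ^ m"
      unfolding K_def m_def using D v \<theta>s by (intro cone_measure_cball_le) auto
    moreover have "k * s ^ m \<le> measure cone_measure (cball v s)"
      unfolding k_def m_def using v s by (intro cone_measure_cball_ge) auto
    ultimately have "k / 2 * s ^ m \<le> measure cone_measure (cball v s) - measure cone_measure (cball v (\<theta> * s))"
      by (simp add: power_mult_distrib)
    also have "\<dots> = measure cone_measure (cball v s - cball v (\<theta> * s))"
      using \<theta>s by (intro N.finite_measure_Diff[symmetric]) auto
    also have "\<dots> = measure cone_measure ?A"
    proof -
      have B: "cball v s - cball v (\<theta> * s) \<in> sets borel" by auto
      \<comment> \<open>The cone measure lives on the unit sphere, since \<open>sgn x\<close> is a
        unit vector for \<open>x \<noteq> 0\<close>.\<close>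
      have eq: "{x. 1 \<le> norm x \<and> norm x \<le> 2 \<and> sgn x \<in> cball v s - cball v (\<theta> * s)}
          = {x. 1 \<le> norm x \<and> norm x \<le> 2 \<and> sgn x \<in> ?A}"
        by (auto simp: norm_sgn)
      show ?thesis unfolding measure_cone_measure[OF Ab] measure_cone_measure[OF B] eq ..
    qed
    finally have "c * (k / 2 * s ^ m) \<le> c * measure cone_measure ?A"
      using c by (intro mult_left_mono) auto
    moreover have "ennreal (c * measure cone_measure ?A) \<le> ennreal (measure spherical_measure ?A)"
    proof -
      have "ennreal (c * measure cone_measure ?A) = ennreal c * emeasure cone_measure ?A"
        using c by (simp only: N.emeasure_eq_measure ennreal_mult')
      also have "\<dots> \<le> hausdorff_outer_measure m ?A" by (rule ge[OF Ab]) auto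
      also have "\<dots> = emeasure spherical_measure ?A"
        unfolding m_def by (rule emeasure_spherical_measure[OF Ab, symmetric]) auto
      finally show ?thesis by (simp only: S.emeasure_eq_measure)
    qed
    then have "c * measure cone_measure ?A \<le> measure spherical_measure ?A"
      by (simp add: ennreal_le_iff)
    ultimately show ?thesis by simp
  qed
  moreover have "0 < c * k / 2" using c pos by simp
  ultimately show ?thesis using \<theta> unfolding m_def by blast
qed

text \<open>Every cap contains an annulus of positive mass. This full support is what later turns a
  strict inequality at one direction into a strict inequality of integrals.\<close>

lemma spherical_measure_cball_pos:
  fixes v :: "'a::euclidean_space"
  assumes D: "2 \<le> DIM('a)" and v: "v \<in> sphere 0 1" and s: "0 < s"
  shows "0 < measure spherical_measure (sphere 0 1 \<inter> cball v s)"
proof -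
  obtain \<theta> c where c: "0 < c" and ge: "\<And>v s. v \<in> sphere (0::'a) 1 \<Longrightarrow> 0 < s \<Longrightarrow> s \<le> 1 \<Longrightarrow>
    c * s ^ (DIM('a) - 1) \<le> measure spherical_measure {u \<in> sphere 0 1. \<theta> * s < dist v u \<and> dist v u \<le> s}"
    using spherical_measure_annulus_ge[OF D] by blast
  interpret S: finite_measure "spherical_measure :: 'a measure"
    using finite_borel_measure_spherical_measure by (auto simp: finite_borel_measure_on_sphere_def)
  let ?s = "min s 1"
  have "0 < c * ?s ^ (DIM('a) - 1)" using c s by simp
  also have "\<dots> \<le> measure spherical_measure {u \<in> sphere 0 1. \<theta> * ?s < dist v u \<and> dist v u \<le> ?s}"
    using v s by (intro ge) auto
  also have "\<dots> \<le> measure spherical_measure (sphere 0 1 \<inter> cball v s)"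
  proof (rule S.finite_measure_mono)
    show "sphere 0 1 \<inter> cball v s \<in> sets spherical_measure"
      by (subst sets_spherical_measure) (auto simp: sets_restrict_space)
  qed auto
  finally show ?thesis .
qed

section \<open>Support functions\<close>

lemma support_function_ge:
  assumes "compact Q" "x \<in> Q"
  shows "x \<bullet> u \<le> support_function Q u"
  unfolding support_function_def
proof (rule cSUP_upper[OF assms(2)])
  show "bdd_above ((\<lambda>x. x \<bullet> u) ` Q)"
    using assms by (intro compact_imp_bounded bounded_imp_bdd_above compact_continuous_image continuous_intros)
qed

lemma support_function_le:
  assumes "Q \<noteq> {}" "\<And>x. x \<in> Q \<Longrightarrow> x \<bullet> u \<le> c"
  shows "support_function Q u \<le> c"
  unfolding support_function_def using assms by (rule cSUP_least)

lemma support_function_eqI: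
  assumes "compact Q" "x \<in> Q" "x \<bullet> u = c" "\<And>y. y \<in> Q \<Longrightarrow> y \<bullet> u \<le> c"
  shows "support_function Q u = c"
  using support_function_ge[OF assms(1,2), of u] support_function_le[of Q u c] assms by force

lemma support_function_attained:
  assumes "compact Q" "Q \<noteq> {}"
  obtains x where "x \<in> Q" "support_function Q u = x \<bullet> u"
proof -
  have "\<exists>x\<in>Q. \<forall>y\<in>Q. y \<bullet> u \<le> x \<bullet> u"
    using assms by (intro continuous_attains_sup continuous_intros)
  then show ?thesis
    using that support_function_eqI[OF assms(1)] by metis
qed

lemma convex_bodies_oE:
  assumes "Q \<in> convex_bodies_o"
  obtains e R where "0 < e" "0 < R" "cball 0 e \<subseteq> Q" "Q \<subseteq> cball 0 R"
    "compact Q" "convex Q" "Q \<noteq> {}"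
proof -
  have Q: "compact Q" "convex Q" "0 \<in> interior Q" using assms by (auto simp: convex_bodies_o_def)
  obtain e where "0 < e" "cball 0 e \<subseteq> Q" using Q(3) by (auto simp: mem_interior_cball)
  moreover obtain R where "0 < R" "Q \<subseteq> cball 0 R"
    using compact_imp_bounded[OF Q(1)] by (auto simp: bounded_pos subset_iff)
  moreover have "Q \<noteq> {}" using Q(3) interior_subset by blast
  ultimately show ?thesis using Q(1,2) that by blast
qed

lemma convex_bodies_oI:
  assumes "compact Q" "convex Q" "0 < e" "cball 0 e \<subseteq> Q"
  shows "Q \<in> convex_bodies_o"
  using assms by (auto simp: convex_bodies_o_def mem_interior_cball)

lemma support_function_ge_radius:
  assumes "compact Q" "cball 0 e \<subseteq> Q" "0 \<le> e" "norm u = 1"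
  shows "e \<le> support_function Q u"
proof -
  have "e *\<^sub>R u \<in> Q" using assms by auto
  from support_function_ge[OF assms(1) this, of u] assms show ?thesis
    by (simp add: dot_square_norm)
qed

lemma support_function_le_radius:
  assumes "Q \<subseteq> cball 0 R" "Q \<noteq> {}" "norm u = 1"
  shows "support_function Q u \<le> R"
proof (rule support_function_le)
  fix x assume "x \<in> Q"
  then have "norm x \<le> R" using assms by auto
  then show "x \<bullet> u \<le> R" using norm_cauchy_schwarz[of x u] assms by simp
qed fact

lemma support_function_lipschitz:
  assumes "compact Q" "Q \<subseteq> cball 0 R" "Q \<noteq> {}"
  shows "support_function Q u \<le> support_function Q w + R * dist u w"
proof (rule support_function_le)
  fix x assume x: "x \<in> Q"
  have "x \<bullet> u = x \<bullet> w + x \<bullet> (u - w)" by (simp add: inner_diff_right)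
  also have "x \<bullet> (u - w) \<le> norm x * norm (u - w)" by (rule norm_cauchy_schwarz)
  also have "\<dots> \<le> R * norm (u - w)" using x assms by (intro mult_right_mono) auto
  finally show "x \<bullet> u \<le> support_function Q w + R * dist u w"
    using support_function_ge[OF assms(1) x, of w] by (simp add: dist_norm)
qed fact

lemma support_function_dist_le:
  assumes "compact Q" "Q \<subseteq> cball 0 R" "Q \<noteq> {}"
  shows "\<bar>support_function Q u - support_function Q w\<bar> \<le> R * dist u w"
  using support_function_lipschitz[OF assms, of u w] support_function_lipschitz[OF assms, of w u]
  by (simp add: dist_commute abs_le_iff)

lemma continuous_on_support_function:
  assumes "Q \<in> convex_bodies_o"
  shows "continuous_on A (support_function Q)"
proof -
  obtain e R where R: "0 < R" "Q \<subseteq> cball 0 R" "compact Q" "Q \<noteq> {}" using assms by (rule convex_bodies_oE)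
  have "R-lipschitz_on A (support_function Q)"
    using R support_function_dist_le[of Q R] by (intro lipschitz_onI) (auto simp: dist_real_def)
  then show ?thesis by (rule lipschitz_on_continuous_on)
qed

lemma support_function_pos:
  assumes "Q \<in> convex_bodies_o" "norm u = 1"
  shows "0 < support_function Q u"
proof -
  obtain e where e: "0 < e" "cball 0 e \<subseteq> Q" "compact Q" using assms(1) by (rule convex_bodies_oE)
  with support_function_ge_radius[of Q e u] assms show ?thesis by simp
qed

section \<open>Polar bodies, recovery of a body from its support function, sums and limits of
  bodies\<close>

lemma radial_function_polar_body:
  assumes Q: "Q \<in> convex_bodies_o" and u: "norm u = 1"
  shows "radial_function (polar_body Q) u = 1 / support_function Q u"
proof -
  have Q': "compact Q" "Q \<noteq> {}" using Q by (auto elim: convex_bodies_oE)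
  have pos: "0 < support_function Q u" using support_function_pos[OF Q u] .
  obtain x where x: "x \<in> Q" "support_function Q u = x \<bullet> u"
    using Q' by (rule support_function_attained)
  have "r *\<^sub>R u \<in> polar_body Q \<longleftrightarrow> r * support_function Q u \<le> 1" if r: "0 \<le> r" for r
  proof
    assume "r *\<^sub>R u \<in> polar_body Q"
    then show "r * support_function Q u \<le> 1" using x by (auto simp: polar_body_def inner_commute)
  next
    assume le: "r * support_function Q u \<le> 1"
    have "r * (u \<bullet> y) \<le> 1" if "y \<in> Q" for y
      using mult_left_mono[OF support_function_ge[OF Q'(1) that, of u] r] le by (simp add: inner_commute)
    then show "r *\<^sub>R u \<in> polar_body Q" by (auto simp: polar_body_def)
  qed
  then have "{r. 0 \<le> r \<and> r *\<^sub>R u \<in> polar_body Q} = {0..1 / support_function Q u}"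
    using pos by (auto simp: pos_le_divide_eq)
  then show ?thesis using pos by (simp add: radial_function_def)
qed

lemma radial_function_cball:
  assumes "norm u = 1"
  shows "radial_function (cball 0 1) u = 1"
proof -
  have "{r. 0 \<le> r \<and> r *\<^sub>R u \<in> cball 0 1} = {0..1}" using assms by auto
  then show ?thesis by (simp add: radial_function_def)
qed

lemma cball_in_convex_bodies_o: "cball 0 1 \<in> convex_bodies_o"
  by (rule convex_bodies_oI[of _ 1]) auto

lemma support_function_cball:
  assumes "norm u = 1"
  shows "support_function (cball 0 1) u = 1"
  by (rule antisym, rule support_function_le_radius)
     (use assms in \<open>auto intro: support_function_ge_radius\<close>)

lemma support_function_less_if_notin:
  fixes Q :: "'a::euclidean_space set"
  assumes "compact Q" "convex Q" "Q \<noteq> {}" "x \<notin> Q"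
  obtains u where "norm u = 1" "support_function Q u < x \<bullet> u"
proof -
  obtain a b where ab: "a \<bullet> x < b" "\<forall>y\<in>Q. b < a \<bullet> y"
    using separating_hyperplane_closed_point[of Q x] assms compact_imp_closed by blast
  then have a: "a \<noteq> 0" using assms(3) by force
  \<comment> \<open>The minus sign is needed because the separation puts \<open>Q\<close> on the
    upper side of the hyperplane.\<close>
  define u where "u = - (a /\<^sub>R norm a)"
  have "norm u = 1" using a by (simp add: u_def)
  moreover obtain y where y: "y \<in> Q" "support_function Q u = y \<bullet> u"
    using assms(1,3) by (rule support_function_attained)
  have "a \<bullet> x < a \<bullet> y" using ab y by force
  then have "y \<bullet> u < x \<bullet> u" using a by (simp add: u_def inner_commute)
  ultimately show ?thesis using y that by simp
qed

text \<open>A point outside \<open>Q2\<close> is separated from it in some direction, where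
  \<open>Q1\<close> would then reach further than \<open>Q2\<close>. Applied in both directions,
  this shows that the support function on the sphere determines the body, which uniqueness
  requires.\<close>

lemma subset_if_support_function_le:
  assumes "Q1 \<in> convex_bodies_o" "Q2 \<in> convex_bodies_o"
    and "\<And>u. norm u = 1 \<Longrightarrow> support_function Q1 u \<le> support_function Q2 u"
  shows "Q1 \<subseteq> Q2"
proof
  fix x assume x: "x \<in> Q1"
  have Q: "compact Q1" "compact Q2" "convex Q2" "Q2 \<noteq> {}" using assms by (auto elim: convex_bodies_oE)
  show "x \<in> Q2"
  proof (rule ccontr)
    assume "x \<notin> Q2"
    then obtain u where "norm u = 1" "support_function Q2 u < x \<bullet> u"
      using support_function_less_if_notin Q by blast
    with assms(3)[of u] support_function_ge[OF Q(1) x, of u] show False by simp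
  qed
qed

text \<open>The body is the scaled Minkowski sum of \<open>Q1\<close> and \<open>Q2\<close>, written
  as a linear image of their product so that compactness and convexity are inherited. The free
  factor \<open>s\<close> lets averaging and shrinking happen in one step.\<close>

lemma minkowski_combination:
  assumes Q1: "Q1 \<in> convex_bodies_o" and Q2: "Q2 \<in> convex_bodies_o" and s: "0 < s"
  obtains Q where "Q \<in> convex_bodies_o"
    "\<And>u. support_function Q u = s * (support_function Q1 u + support_function Q2 u)"
proof
  define f where "f = (\<lambda>z. s *\<^sub>R (fst z + snd z) :: 'a)"
  have lin: "linear f" by (auto simp: f_def intro!: linearI simp: algebra_simps)
  have cont: "continuous_on A f" for A unfolding f_def by (intro continuous_intros)
  obtain e where e: "0 < e" "cball 0 e \<subseteq> Q1" "compact Q1" "convex Q1" "Q1 \<noteq> {}"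
    using Q1 by (rule convex_bodies_oE)
  obtain e2 where e2: "0 < e2" "cball 0 e2 \<subseteq> Q2" "compact Q2" "convex Q2" "Q2 \<noteq> {}"
    using Q2 by (rule convex_bodies_oE)
  have comp: "compact (f ` (Q1 \<times> Q2))"
    using e e2 by (intro compact_continuous_image cont compact_Times)
  show "f ` (Q1 \<times> Q2) \<in> convex_bodies_o"
  proof (rule convex_bodies_oI[OF comp])
    show "convex (f ` (Q1 \<times> Q2))"
      using e e2 by (intro convex_linear_image lin convex_Times)
    show "0 < s * e" using s e by simp
    show "cball 0 (s * e) \<subseteq> f ` (Q1 \<times> Q2)"
    proof
      fix x :: 'a assume x: "x \<in> cball 0 (s * e)"
      have "x /\<^sub>R s \<in> Q1" using x s e(2) by (auto simp: pos_divide_le_eq field_simps)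
      moreover have "0 \<in> Q2" using subsetD[OF e2(2), of 0] e2(1) by simp
      moreover have "x = f (x /\<^sub>R s, 0)" using s by (simp add: f_def)
      ultimately show "x \<in> f ` (Q1 \<times> Q2)" by blast
    qed
  qed
  fix u
  obtain x where x: "x \<in> Q1" "support_function Q1 u = x \<bullet> u"
    using e(3,5) by (rule support_function_attained)
  obtain y where y: "y \<in> Q2" "support_function Q2 u = y \<bullet> u"
    using e2(3,5) by (rule support_function_attained)
  show "support_function (f ` (Q1 \<times> Q2)) u = s * (support_function Q1 u + support_function Q2 u)"
  proof (rule support_function_eqI[OF comp])
    show "f (x, y) \<in> f ` (Q1 \<times> Q2)" using x y by blast
    show "f (x, y) \<bullet> u = s * (support_function Q1 u + support_function Q2 u)"
      by (simp add: f_def x y inner_add_left)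
    fix z assume "z \<in> f ` (Q1 \<times> Q2)"
    then obtain a b where ab: "a \<in> Q1" "b \<in> Q2" "z = f (a, b)" by auto
    have "z \<bullet> u = s * (a \<bullet> u + b \<bullet> u)" by (simp add: ab f_def inner_add_left)
    also have "\<dots> \<le> s * (support_function Q1 u + support_function Q2 u)"
      using s support_function_ge[OF e(3) ab(1), of u] support_function_ge[OF e2(3) ab(2), of u]
      by (intro mult_left_mono add_mono) auto
    finally show "z \<bullet> u \<le> s * (support_function Q1 u + support_function Q2 u)" .
  qed
qed

text \<open>The body is the Wulff shape of \<open>h\<close>, cut by the common bounding ball. Its
  support function is at most \<open>h\<close> by construction. For equality in direction
  \<open>u\<close>, points of \<open>Q k\<close> extremal in that direction accumulate at a point
  that satisfies all the constraints and has inner product \<open>h u\<close> with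
  \<open>u\<close>.\<close>

lemma support_function_limit_body:
  fixes Q :: "nat \<Rightarrow> 'a::euclidean_space set"
  assumes Q: "\<And>k. Q k \<in> convex_bodies_o" "\<And>k. Q k \<subseteq> cball 0 R"
    and lim: "\<And>u. norm u = 1 \<Longrightarrow> (\<lambda>k. support_function (Q k) u) \<longlonglongrightarrow> h u"
    and e: "0 < e" "\<And>u. norm u = 1 \<Longrightarrow> e \<le> h u"
  obtains M where "M \<in> convex_bodies_o" "\<And>u. norm u = 1 \<Longrightarrow> support_function M u = h u"
proof
  have Qc: "compact (Q k)" "Q k \<noteq> {}" for k using Q(1)[of k] by (auto elim: convex_bodies_oE)
  define M where "M = (\<Inter>u\<in>sphere 0 1. {x. x \<bullet> u \<le> h u}) \<inter> cball 0 R"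
  have inner_lim: "x \<bullet> u \<le> h u" if "strict_mono r" "(x' \<circ> r) \<longlonglongrightarrow> x" "\<And>k. x' k \<in> Q k" "norm u = 1" for x' x u r
  proof (rule LIMSEQ_le)
    show "(\<lambda>k. (x' \<circ> r) k \<bullet> u) \<longlonglongrightarrow> x \<bullet> u" using that by (intro tendsto_intros)
    show "(\<lambda>k. support_function (Q (r k)) u) \<longlonglongrightarrow> h u"
      using LIMSEQ_subseq_LIMSEQ[OF lim[OF that(4)] that(1)] by (simp add: o_def)
    show "\<exists>N. \<forall>k\<ge>N. (x' \<circ> r) k \<bullet> u \<le> support_function (Q (r k)) u"
      using that Qc by (auto intro!: support_function_ge)
  qed
  have att: "\<exists>x\<in>M. x \<bullet> u = h u" if u: "norm u = 1" for u
  proof -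
    have "\<exists>x\<in>Q k. support_function (Q k) u = x \<bullet> u" for k
      using support_function_attained[OF Qc] by blast
    then obtain x' where x': "\<And>k. x' k \<in> Q k" "\<And>k. support_function (Q k) u = x' k \<bullet> u"
      by metis
    have "\<forall>k. x' k \<in> cball 0 R" using x'(1) Q(2) by blast
    then obtain x r where r: "x \<in> cball 0 R" "strict_mono (r::nat\<Rightarrow>nat)" "(x' \<circ> r) \<longlonglongrightarrow> x"
      using compact_cball[unfolded compact_def, of "0::'a" R] by metis
    have "x \<in> M" using r inner_lim[OF r(2,3) x'(1)] by (auto simp: M_def)
    moreover have "(\<lambda>k. (x' \<circ> r) k \<bullet> u) \<longlonglongrightarrow> x \<bullet> u" using r by (intro tendsto_intros)
    then have "(\<lambda>k. support_function (Q (r k)) u) \<longlonglongrightarrow> x \<bullet> u" by (simp add: x')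
    then have "x \<bullet> u = h u"
      using LIMSEQ_subseq_LIMSEQ[OF lim[OF u] r(2)] LIMSEQ_unique by (fastforce simp: o_def)
    ultimately show ?thesis by blast
  qed
  have M: "compact M" "convex M"
    unfolding M_def by (auto intro!: closed_Int_compact closed_INT closed_halfspace_le convex_Int convex_INT
      simp: convex_halfspace_le inner_commute closed_halfspace_le[simplified inner_commute])
  have "cball 0 (min e R) \<subseteq> M"
  proof
    fix x :: 'a assume x: "x \<in> cball 0 (min e R)"
    have "x \<bullet> u \<le> h u" if "norm u = 1" for u
      using norm_cauchy_schwarz[of x u] e(2)[OF that] that x by auto
    with x show "x \<in> M" by (auto simp: M_def)
  qed
  moreover have "0 < R"
  proof -
    obtain e' where "0 < e'" "cball 0 e' \<subseteq> Q 0" using Q(1)[of 0] by (rule convex_bodies_oE)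
    with Q(2)[of 0] have "cball (0::'a) e' \<subseteq> cball 0 R" by blast
    with \<open>0 < e'\<close> show ?thesis by (simp add: cball_subset_cball_iff)
  qed
  ultimately show "M \<in> convex_bodies_o" using M e(1) by (intro convex_bodies_oI[of M "min e R"]) auto
  fix u :: 'a assume "norm u = 1"
  with att obtain x where "x \<in> M" "x \<bullet> u = h u" by blast
  then show "support_function M u = h u"
    using M(1) \<open>norm u = 1\<close> by (intro support_function_eqI) (auto simp: M_def)
qed

section \<open>Integrals of continuous weights over the sphere\<close>

lemma space_finite_borel_measure_on_sphere:
  assumes "finite_borel_measure_on_sphere M"
  shows "space M = sphere 0 1"
  using assms sets_eq_imp_space_eq[of M "restrict_space borel (sphere 0 1)"]
  by (auto simp: finite_borel_measure_on_sphere_def space_restrict_space)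

lemma sets_finite_borel_measure_on_sphere:
  assumes "finite_borel_measure_on_sphere M" "A \<in> sets borel" "A \<subseteq> sphere 0 1"
  shows "A \<in> sets M"
  using assms by (auto simp: finite_borel_measure_on_sphere_def sets_restrict_space)

lemma measurable_continuous_on_sphere:
  fixes f :: "'a::euclidean_space \<Rightarrow> real"
  assumes "finite_borel_measure_on_sphere M" "continuous_on (sphere 0 1) f"
  shows "f \<in> borel_measurable M"
  using borel_measurable_continuous_on_restrict[OF assms(2)] assms(1)
    measurable_cong_sets[of M "restrict_space borel (sphere 0 1)" borel borel]
  by (auto simp: finite_borel_measure_on_sphere_def)

lemma integrable_continuous_on_sphere:
  fixes f :: "'a::euclidean_space \<Rightarrow> real"
  assumes M: "finite_borel_measure_on_sphere M" and f: "continuous_on (sphere 0 1) f"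
  shows "integrable M f"
proof -
  interpret finite_measure M using M by (simp add: finite_borel_measure_on_sphere_def)
  have "bounded (f ` sphere 0 1)"
    using f by (intro compact_imp_bounded compact_continuous_image) auto
  then obtain B where "\<forall>u\<in>sphere 0 1. norm (f u) \<le> B" by (auto simp: bounded_iff)
  then show ?thesis
    using M f space_finite_borel_measure_on_sphere[OF M]
    by (intro integrable_const_bound[where B = B] AE_I2 measurable_continuous_on_sphere) auto
qed

lemma sphere_bounds_pos:
  fixes f :: "'a::euclidean_space \<Rightarrow> real"
  assumes f: "continuous_on (sphere 0 1) f" "\<And>u. u \<in> sphere 0 1 \<Longrightarrow> 0 < f u"
  shows "\<exists>a b. 0 < a \<and> 0 < b \<and> (\<forall>u\<in>sphere 0 1. a \<le> f u \<and> f u \<le> b)"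
proof -
  have S: "compact (sphere (0::'a) 1)" "sphere (0::'a) 1 \<noteq> {}"
    by auto
  obtain p where p: "p \<in> sphere 0 1" "\<And>u. u \<in> sphere 0 1 \<Longrightarrow> f p \<le> f u"
    using continuous_attains_inf[OF S f(1)] by blast
  obtain q where q: "q \<in> sphere 0 1" "\<And>u. u \<in> sphere 0 1 \<Longrightarrow> f u \<le> f q"
    using continuous_attains_sup[OF S f(1)] by blast
  show ?thesis using p q f(2) by blast
qed

lemma continuous_on_weight_comp:
  fixes F :: "real \<Rightarrow> 'a::euclidean_space \<Rightarrow> real"
  assumes F: "continuous_on ({0<..} \<times> sphere 0 1) (\<lambda>(t, u). F t u)"
    and f: "continuous_on (sphere 0 1) f" "\<And>u. u \<in> sphere 0 1 \<Longrightarrow> 0 < f u"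
  shows "continuous_on (sphere 0 1) (\<lambda>u. F (f u) u)"
proof -
  have "continuous_on (sphere 0 1) (\<lambda>u. (f u, u))" using f by (intro continuous_intros)
  moreover have "(\<lambda>u. (f u, u)) ` sphere 0 1 \<subseteq> {0<..} \<times> sphere 0 1" using f by auto
  ultimately have "continuous_on (sphere 0 1) (\<lambda>u. case (f u, u) of (t, u) \<Rightarrow> F t u)"
    by (rule continuous_on_compose2[OF F])
  then show ?thesis by simp
qed

text \<open>On the compact set of pairs with first entry in \<open>{a..b}\<close> the weight is
  bounded, so a constant dominates. The lemma serves the dual volume and, with a weight independent
  of the direction, the integral that defines the Orlicz norm.\<close>

lemma integral_weight_tendsto:
  fixes F :: "real \<Rightarrow> 'a::euclidean_space \<Rightarrow> real"
  assumes M: "finite_borel_measure_on_sphere M"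
    and F: "continuous_on ({0<..} \<times> sphere 0 1) (\<lambda>(t, u). F t u)"
    and f: "\<And>k. continuous_on (sphere 0 1) (f k)" "continuous_on (sphere 0 1) g"
    and lim: "\<And>u. u \<in> sphere 0 1 \<Longrightarrow> (\<lambda>k. f k u) \<longlonglongrightarrow> g u"
    and a: "0 < a" and ab: "\<And>k u. u \<in> sphere 0 1 \<Longrightarrow> a \<le> f k u \<and> f k u \<le> b"
  shows "(\<lambda>k. \<integral>u. F (f k u) u \<partial>M) \<longlonglongrightarrow> (\<integral>u. F (g u) u \<partial>M)"
proof -
  interpret finite_measure M using M by (simp add: finite_borel_measure_on_sphere_def)
  have g: "a \<le> g u" if "u \<in> sphere 0 1" for u
    using lim[OF that] ab[OF that] by (intro LIMSEQ_le_const[of "\<lambda>k. f k u"]) auto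
  have "bounded ((\<lambda>(t, u). F t u) ` ({a..b} \<times> sphere 0 1))"
    using a by (intro compact_imp_bounded compact_continuous_image compact_Times
      continuous_on_subset[OF F]) auto
  then obtain B where "\<forall>y\<in>(\<lambda>(t, u). F t u) ` ({a..b} \<times> sphere 0 1). norm y \<le> B"
    unfolding bounded_iff ..
  then have B: "\<bar>F t u\<bar> \<le> B" if "t \<in> {a..b}" "u \<in> sphere 0 1" for t u
    using that by simp
  have gpos: "0 < g u" and fpos: "0 < f k u" if "u \<in> sphere 0 1" for u k
    using g[OF that] ab[OF that, of k] a by linarith+
  have sp: "space M = sphere 0 1" using M by (rule space_finite_borel_measure_on_sphere)
  show ?thesis
  proof (rule integral_dominated_convergence[where w = "\<lambda>_. B"])
    show "(\<lambda>u. F (g u) u) \<in> borel_measurable M"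
      by (intro measurable_continuous_on_sphere[OF M] continuous_on_weight_comp[OF F] f gpos)
    show "(\<lambda>u. F (f k u) u) \<in> borel_measurable M" for k
      by (intro measurable_continuous_on_sphere[OF M] continuous_on_weight_comp[OF F] f fpos)
    show "integrable M (\<lambda>_. B)" by simp
    show "AE u in M. norm (F (f k u) u) \<le> B" for k
      using B ab by (intro AE_I2) (auto simp: sp)
    show "AE u in M. (\<lambda>k. F (f k u) u) \<longlonglongrightarrow> F (g u) u"
    proof (rule AE_I2)
      fix u assume "u \<in> space M"
      then have u: "u \<in> sphere 0 1" using sp by simp
      have "(\<lambda>k. (f k u, u)) \<longlonglongrightarrow> (g u, u)" using lim[OF u] by (intro tendsto_intros)
      from continuous_on_tendsto_compose[OF F this] gpos[OF u] fpos[OF u] u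
      show "(\<lambda>k. F (f k u) u) \<longlonglongrightarrow> F (g u) u" by simp
    qed
  qed
qed

text \<open>By continuity \<open>f\<close> stays above \<open>f v / 2\<close> on a cap about
  \<open>v\<close>, and this cap has positive mass.\<close>

lemma integral_spherical_measure_pos:
  fixes f :: "'a::euclidean_space \<Rightarrow> real"
  assumes D: "2 \<le> DIM('a)" and f: "continuous_on (sphere 0 1) f" "\<And>u. u \<in> sphere 0 1 \<Longrightarrow> 0 \<le> f u"
    and v: "v \<in> sphere 0 1" "0 < f v"
  shows "0 < (\<integral>u. f u \<partial>spherical_measure)"
proof -
  let ?\<sigma> = "spherical_measure :: 'a measure"
  have M: "finite_borel_measure_on_sphere ?\<sigma>" by (rule finite_borel_measure_spherical_measure)
  interpret finite_measure ?\<sigma> using M by (simp add: finite_borel_measure_on_sphere_def)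
  obtain d where d: "0 < d" "\<And>u. u \<in> sphere 0 1 \<Longrightarrow> dist u v < d \<Longrightarrow> dist (f u) (f v) < f v / 2"
    using f(1) v unfolding continuous_on_iff by (metis half_gt_zero)
  let ?A = "sphere 0 1 \<inter> cball v (d / 2)"
  have A: "?A \<in> sets ?\<sigma>" by (rule sets_finite_borel_measure_on_sphere[OF M]) auto
  have "0 < f v / 2 * measure ?\<sigma> ?A"
    using spherical_measure_cball_pos[OF D v(1), of "d / 2"] d v by simp
  also have "\<dots> = (\<integral>u. f v / 2 * indicator ?A u \<partial>?\<sigma>)"
    using A by simp
  also have "\<dots> \<le> (\<integral>u. f u \<partial>?\<sigma>)"
  proof (rule integral_mono)
    show "integrable ?\<sigma> (\<lambda>u. f v / 2 * indicator ?A u)"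
      using A by (intro integrable_mult_right integrable_real_indicator) (auto simp: less_top[symmetric])
    show "integrable ?\<sigma> f" using M f(1) by (rule integrable_continuous_on_sphere)
    fix u assume "u \<in> space ?\<sigma>"
    then have u: "u \<in> sphere 0 1" using space_finite_borel_measure_on_sphere[OF M] by simp
    show "f v / 2 * indicator ?A u \<le> f u"
    proof (cases "u \<in> ?A")
      case True
      then have "dist (f u) (f v) < f v / 2" using d u by (auto simp: dist_commute)
      then have "f v / 2 \<le> f u" unfolding dist_real_def by linarith
      with True show ?thesis by simp
    next
      case False
      with f(2)[OF u] show ?thesis by simp
    qed
  qed
  finally show ?thesis .
qed

lemma space_spherical_measure [simp]: "space (spherical_measure :: 'a::euclidean_space measure) = sphere 0 1"
  by (rule space_finite_borel_measure_on_sphere[OF finite_borel_measure_spherical_measure])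

text \<open>The assumptions are chosen to survive the passage from \<open>G t u\<close> to
  \<open>G (t / \<eta>) u\<close>, by which the homogeneous problem is treated. Hence the free
  threshold \<open>T\<close> in the growth condition: rescaling moves it.\<close>

locale radial_weight =
  fixes G :: "real \<Rightarrow> 'a::euclidean_space \<Rightarrow> real"
  assumes dim: "2 \<le> DIM('a)"
    and continuous_weight: "continuous_on ({0<..} \<times> sphere 0 1) (\<lambda>(t, u). G t u)"
    and weight_pos: "\<And>t u. 0 < t \<Longrightarrow> u \<in> sphere 0 1 \<Longrightarrow> 0 < G t u"
    and weight_mono: "\<And>u. u \<in> sphere 0 1 \<Longrightarrow> strict_mono_on {0<..} (\<lambda>t. G t u)"
    and growth: "\<exists>c>0. \<exists>T>0. \<forall>t\<ge>T. \<forall>u\<in>sphere 0 1. c * t ^ (DIM('a) - 1) \<le> G t u"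
begin

text \<open>For \<open>f\<close> a support function this is the general dual volume of the polar
  body. It accepts any function on the sphere so that limits, means and multiples can be inserted
  directly.\<close>

definition weight_integral :: "('a \<Rightarrow> real) \<Rightarrow> real" where
  "weight_integral f = (\<integral>u. G (1 / f u) u \<partial>spherical_measure)"

lemma weight_integrable:
  assumes "continuous_on (sphere 0 1) f" "\<And>u. u \<in> sphere 0 1 \<Longrightarrow> 0 < f u"
  shows "continuous_on (sphere 0 1) (\<lambda>u. G (1 / f u) u)"
    and "integrable spherical_measure (\<lambda>u. G (1 / f u) u)"
proof -
  have "\<forall>u\<in>sphere 0 1. f u \<noteq> 0" using assms(2) by force
  then show "continuous_on (sphere 0 1) (\<lambda>u. G (1 / f u) u)"
    by (intro continuous_on_weight_comp[OF continuous_weight] continuous_on_divide continuous_on_const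
        assms divide_pos_pos zero_less_one)
  then show "integrable spherical_measure (\<lambda>u. G (1 / f u) u)"
    by (intro integrable_continuous_on_sphere finite_borel_measure_spherical_measure)
qed

lemma weight_le: "0 < s \<Longrightarrow> s \<le> t \<Longrightarrow> u \<in> sphere 0 1 \<Longrightarrow> G s u \<le> G t u"
  using strict_mono_on_leD[OF weight_mono, of u s t] by simp

lemma weight_integral_antimono:
  assumes "continuous_on (sphere 0 1) f" "\<And>u. u \<in> sphere 0 1 \<Longrightarrow> 0 < f u"
    and "continuous_on (sphere 0 1) g" "\<And>u. u \<in> sphere 0 1 \<Longrightarrow> f u \<le> g u"
  shows "weight_integral g \<le> weight_integral f"
  unfolding weight_integral_def
proof (rule integral_mono)
  have g: "0 < g u" if "u \<in> sphere 0 1" for u using assms that by (meson less_le_trans)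
  show "integrable spherical_measure (\<lambda>u. G (1 / g u) u)" using assms(3) g by (rule weight_integrable)
  show "integrable spherical_measure (\<lambda>u. G (1 / f u) u)" using assms(1,2) by (rule weight_integrable)
  fix u :: 'a assume "u \<in> space spherical_measure"
  then have u: "u \<in> sphere 0 1" by simp
  show "G (1 / g u) u \<le> G (1 / f u) u"
    using assms(2)[OF u] assms(4)[OF u] g[OF u] u by (intro weight_le frac_le) auto
qed

lemma weight_integral_tendsto:
  assumes "\<And>k. continuous_on (sphere 0 1) (f k)" "continuous_on (sphere 0 1) g"
    and "\<And>u. u \<in> sphere 0 1 \<Longrightarrow> (\<lambda>k. f k u) \<longlonglongrightarrow> g u"
    and a: "0 < a" and ab: "\<And>k u. u \<in> sphere 0 1 \<Longrightarrow> a \<le> f k u \<and> f k u \<le> b"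
  shows "(\<lambda>k. weight_integral (f k)) \<longlonglongrightarrow> weight_integral g"
  unfolding weight_integral_def
proof (rule integral_weight_tendsto[where F = G and f = "\<lambda>k u. 1 / f k u" and g = "\<lambda>u. 1 / g u"
      and a = "1 / b" and b = "1 / a"])
  have pos: "0 < f k u" if "u \<in> sphere 0 1" for k u using ab[OF that] a by (meson less_le_trans)
  have g: "a \<le> g u" if "u \<in> sphere 0 1" for u
    using assms(3)[OF that] ab[OF that] by (intro LIMSEQ_le_const[of "\<lambda>k. f k u"]) auto
  then have g0: "g u \<noteq> 0" if "u \<in> sphere 0 1" for u using that a by fastforce
  have f0: "\<forall>u\<in>sphere 0 1. f k u \<noteq> 0" for k using pos[of _ k] by (metis less_irrefl)
  show "continuous_on (sphere 0 1) (\<lambda>u. 1 / f k u)" for k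
    by (rule continuous_on_divide[OF continuous_on_const assms(1) f0])
  show "continuous_on (sphere 0 1) (\<lambda>u. 1 / g u)"
    using g0 by (intro continuous_on_divide continuous_on_const assms) auto
  show "(\<lambda>k. 1 / f k u) \<longlonglongrightarrow> 1 / g u" if "u \<in> sphere 0 1" for u
    using g0[OF that] by (intro tendsto_intros assms that)
  obtain v :: 'a where v: "v \<in> sphere 0 1" using vector_choose_size[of 1] by auto
  have "0 < b" using ab[OF v] a by (meson less_le_trans)
  then show "0 < 1 / b" by simp
  show "1 / b \<le> 1 / f k u \<and> 1 / f k u \<le> 1 / a" if "u \<in> sphere 0 1" for k u
    using ab[OF that] a pos[OF that] \<open>0 < b\<close> by (auto intro!: frac_le)
qed (rule finite_borel_measure_spherical_measure continuous_weight)+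

text \<open>Near a direction \<open>v\<close> with small \<open>h v\<close>, the reciprocal of the Lipschitz function \<open>h\<close> is at least
  of order \<open>1 / dist v u\<close>, whose power with the critical exponent \<open>n - 1\<close> has a divergent integral:
  each of the annuli around \<open>v\<close> contributes at least a fixed amount.\<close>

lemma weight_integral_bounded_imp_inradius:
  assumes R: "0 < R"
  shows "\<exists>\<epsilon>>0. \<forall>h. continuous_on (sphere 0 1) h \<longrightarrow> (\<forall>u\<in>sphere 0 1. 0 < h u) \<longrightarrow>
    (\<forall>u\<in>sphere 0 1. \<forall>w\<in>sphere 0 1. h u \<le> h w + R * dist u w) \<longrightarrow> weight_integral h \<le> V \<longrightarrow>
    (\<forall>u\<in>sphere 0 1. \<epsilon> \<le> h u)"
proof -
  let ?\<sigma> = "spherical_measure :: 'a measure"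
  define m where "m = DIM('a) - 1"
  have M: "finite_borel_measure_on_sphere ?\<sigma>" by (rule finite_borel_measure_spherical_measure)
  interpret finite_measure ?\<sigma> using M by (simp add: finite_borel_measure_on_sphere_def)
  obtain \<theta> c where \<theta>: "0 < \<theta>" "\<theta> < 1" and c: "0 < c"
    and ge: "\<And>v s. v \<in> sphere (0::'a) 1 \<Longrightarrow> 0 < s \<Longrightarrow> s \<le> 1 \<Longrightarrow>
      c * s ^ m \<le> measure ?\<sigma> {u \<in> sphere 0 1. \<theta> * s < dist v u \<and> dist v u \<le> s}"
    using spherical_measure_annulus_ge[OF dim] unfolding m_def by blast
  obtain c' T where c': "0 < c'" and T: "0 < T"
    and gr: "\<And>t u. T \<le> t \<Longrightarrow> u \<in> sphere 0 1 \<Longrightarrow> c' * t ^ m \<le> G t u"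
    using growth unfolding m_def by blast
  \<comment> \<open>The ratio \<open>\<theta>\<close> makes consecutive radii bound exactly the
    annuli of the mass estimate. The initial radius keeps \<open>s j\<close> at most 1, as that
    estimate requires, and \<open>2 * R * s j\<close> at most \<open>1 / T\<close>, so that the
    growth condition applies to its reciprocal.\<close>
  define s where "s j = \<theta> ^ j * min 1 (1 / (2 * R * T))" for j :: nat
  \<comment> \<open>The contribution of one annulus: the growth bound
    \<open>c' * (1 / (2 * R * s j)) ^ m\<close> times the mass bound \<open>c * s j ^ m\<close>, in
    which \<open>s j\<close> cancels.\<close>
  define \<kappa> where "\<kappa> = c' * c / (2 * R) ^ m"
  have \<kappa>: "0 < \<kappa>" using c c' R by (simp add: \<kappa>_def)
  have s0: "0 < s j" for j using \<theta> R T by (simp add: s_def)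
  have s1: "s j \<le> 1" "s j \<le> 1 / (2 * R * T)" for j
  proof -
    have "s j \<le> 1 * min 1 (1 / (2 * R * T))"
      unfolding s_def using \<theta> R T by (intro mult_right_mono power_le_one) auto
    then show "s j \<le> 1" "s j \<le> 1 / (2 * R * T)" by auto
  qed
  have s_anti: "s i \<le> s j" if "j \<le> i" for i j
    unfolding s_def using \<theta> R T that by (intro mult_right_mono power_decreasing) auto
  have s_Suc: "s (Suc j) = \<theta> * s j" for j by (simp add: s_def)
  \<comment> \<open>More than \<open>V / \<kappa>\<close> annuli exceed the allowed volume. The
    inradius bound is \<open>R * s N\<close>: were \<open>h v\<close> below it, the Lipschitz
    estimate would give \<open>h u \<le> R * s N + R * s j \<le> 2 * R * s j\<close> on each annulus
    with \<open>j < N\<close>.\<close>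
  obtain N where N: "V / \<kappa> < real N" using reals_Archimedean2 by blast
  have "R * s N \<le> h v" if h: "continuous_on (sphere 0 1) h" "\<forall>u\<in>sphere 0 1. 0 < h u"
      "\<forall>u\<in>sphere 0 1. \<forall>w\<in>sphere 0 1. h u \<le> h w + R * dist u w" "weight_integral h \<le> V"
      and v: "v \<in> sphere 0 1" for h v
  proof (rule ccontr)
    assume "\<not> R * s N \<le> h v"
    then have hv: "h v \<le> R * s N" by simp
    define A where "A j = {u \<in> sphere 0 1. s (Suc j) < dist v u \<and> dist v u \<le> s j}" for j
    have "A j = (cball v (s j) - cball v (s (Suc j))) \<inter> sphere 0 1" for j by (auto simp: A_def)
    then have A: "A j \<in> sets ?\<sigma>" for j
      by (intro sets_finite_borel_measure_on_sphere[OF M]) auto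
    have disj: "disjoint_family_on A {..<N}"
      unfolding disjoint_family_on_def
    proof (intro ballI impI)
      have *: "A i \<inter> A j = {}" if "j < i" for i j
        using s_anti[of "Suc j" i] that by (fastforce simp: A_def)
      fix i j :: nat assume "i \<noteq> j"
      then show "A i \<inter> A j = {}" using *[of i j] *[of j i] by (cases i j rule: linorder_cases) auto
    qed
    have le: "(\<Sum>j<N. c' * (1 / (2 * R * s j)) ^ m * indicator (A j) u) \<le> G (1 / h u) u"
      if u: "u \<in> sphere 0 1" for u
    proof -
      have hu: "0 < h u" using h u by blast
      have "c' * (1 / (2 * R * s j)) ^ m * indicator (A j) u \<le> G (1 / h u) u * indicator (A j) u"
        if "j < N" for j
      proof (cases "u \<in> A j")
        case True
        have "h u \<le> h v + R * dist u v" using h u v by blast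
        also have "\<dots> \<le> R * s N + R * s j"
          using hv True R by (intro add_mono mult_left_mono) (auto simp: A_def dist_commute)
        also have "\<dots> \<le> 2 * R * s j"
          using s_anti[of j N] that R by simp
        finally have hu2: "h u \<le> 2 * R * s j" .
        have "2 * R * s j * T \<le> 1" using s1(2)[of j] R T by (simp add: field_simps)
        then have "T \<le> 1 / (2 * R * s j)" using R s0[of j] by (simp add: field_simps)
        moreover have "1 / (2 * R * s j) \<le> 1 / h u" using hu hu2 by (intro frac_le) auto
        ultimately have "c' * (1 / (2 * R * s j)) ^ m \<le> G (1 / h u) u"
          using gr[of "1 / (2 * R * s j)" u] weight_le[of "1 / (2 * R * s j)" "1 / h u" u] u R s0[of j]
          by simp
        with True show ?thesis by simp
      qed simp
      then have "(\<Sum>j<N. c' * (1 / (2 * R * s j)) ^ m * indicator (A j) u)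
          \<le> (\<Sum>j<N. G (1 / h u) u * indicator (A j) u)"
        by (intro sum_mono) auto
      also have "\<dots> = G (1 / h u) u * indicator (\<Union>j<N. A j) u"
        using disj by (simp add: sum_distrib_left indicator_UN_disjoint)
      also have "\<dots> \<le> G (1 / h u) u"
        using weight_pos[of "1 / h u" u] u hu by (simp add: indicator_def)
      finally show ?thesis .
    qed
    have int: "integrable ?\<sigma> (\<lambda>u. c' * (1 / (2 * R * s j)) ^ m * indicator (A j) u)" for j
      using A by (intro integrable_mult_right integrable_real_indicator) (auto simp: less_top[symmetric])
    have "\<kappa> \<le> (\<integral>u. c' * (1 / (2 * R * s j)) ^ m * indicator (A j) u \<partial>?\<sigma>)" for j
    proof -
      have "A j \<inter> sphere 0 1 = A j" by (auto simp: A_def)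
      have "\<kappa> = c' * (1 / (2 * R * s j)) ^ m * (c * s j ^ m)"
        using R s0[of j] by (simp add: \<kappa>_def power_mult_distrib power_divide)
      also have "\<dots> \<le> c' * (1 / (2 * R * s j)) ^ m * measure ?\<sigma> (A j)"
        using ge[OF v s0 s1(1), of j] c' R s0[of j]
        by (intro mult_left_mono) (auto simp: A_def s_Suc)
      also have "\<dots> = (\<integral>u. c' * (1 / (2 * R * s j)) ^ m * indicator (A j) u \<partial>?\<sigma>)"
        using A[of j] \<open>A j \<inter> sphere 0 1 = A j\<close> by simp
      finally show ?thesis .
    qed
    then have "(\<Sum>j<N. \<kappa>) \<le> (\<Sum>j<N. \<integral>u. c' * (1 / (2 * R * s j)) ^ m * indicator (A j) u \<partial>?\<sigma>)"
      by (intro sum_mono)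
    also have "\<dots> = (\<integral>u. (\<Sum>j<N. c' * (1 / (2 * R * s j)) ^ m * indicator (A j) u) \<partial>?\<sigma>)"
      using int by (intro Bochner_Integration.integral_sum[symmetric])
    also have "\<dots> \<le> weight_integral h"
      unfolding weight_integral_def
      using int h le space_finite_borel_measure_on_sphere[OF M]
      by (intro integral_mono Bochner_Integration.integrable_sum weight_integrable) auto
    finally have "real N * \<kappa> \<le> V" using h by simp
    with N \<kappa> show False by (simp add: field_simps)
  qed
  moreover have "0 < R * s N" using R s0 by simp
  ultimately show ?thesis by blast
qed

end

section \<open>Orlicz norms\<close>

locale orlicz_data =
  fixes \<phi> :: "real \<Rightarrow> real" and \<mu> :: "'a::euclidean_space measure"
  assumes phi: "\<phi> \<in> class_I"
    and borel_mu: "finite_borel_measure_on_sphere \<mu>"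
    and mass_nonzero: "measure \<mu> (sphere 0 1) \<noteq> 0"
    and not_concentrated: "not_concentrated_on_closed_hemisphere \<mu>"
begin

sublocale mu: finite_measure \<mu>
  using borel_mu by (simp add: finite_borel_measure_on_sphere_def)

lemma space_mu [simp]: "space \<mu> = sphere 0 1"
  using borel_mu by (rule space_finite_borel_measure_on_sphere)

lemma mass_pos: "0 < measure \<mu> (sphere 0 1)"
  using mass_nonzero by (simp add: less_le)

lemma phi_mono: "0 < s \<Longrightarrow> s \<le> t \<Longrightarrow> \<phi> s \<le> \<phi> t"
  using phi strict_mono_on_leD[of "{0<..}" \<phi> s t] by (simp add: class_I_def)

lemma phi_strict_mono: "0 < s \<Longrightarrow> s < t \<Longrightarrow> \<phi> s < \<phi> t"
  using phi strict_mono_onD[of "{0<..}" \<phi> s t] by (simp add: class_I_def)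

lemma phi_one: "\<phi> 1 = 1" and phi_pos: "0 < t \<Longrightarrow> 0 < \<phi> t"
  using phi by (auto simp: class_I_def)

lemma continuous_phi_weight: "continuous_on ({0<..} \<times> sphere 0 1) (\<lambda>(t, u :: 'a). \<phi> t)"
proof -
  have "continuous_on {0<..} \<phi>" using phi by (simp add: class_I_def)
  then have "continuous_on ({0<..} \<times> sphere (0 :: 'a) 1) (\<lambda>z. \<phi> (fst z))"
    by (rule continuous_on_compose2) (auto intro: continuous_intros)
  then show ?thesis by (simp add: case_prod_unfold)
qed

lemma phi_integrable:
  assumes "continuous_on (sphere 0 1) f" "\<And>u. u \<in> sphere 0 1 \<Longrightarrow> 0 < f u" "0 < r"
  shows "integrable \<mu> (\<lambda>u. \<phi> (f u / r))"
  using assms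
  by (intro integrable_continuous_on_sphere[OF borel_mu] continuous_on_weight_comp[OF continuous_phi_weight]
      continuous_on_divide continuous_on_const divide_pos_pos) auto

definition admissible :: "('a \<Rightarrow> real) \<Rightarrow> real \<Rightarrow> bool" where
  "admissible f r \<longleftrightarrow> 0 < r \<and> (\<integral>u. \<phi> (f u / r) \<partial>\<mu>) \<le> measure \<mu> (sphere 0 1)"

lemma orlicz_norm_eq: "orlicz_norm \<mu> \<phi> f = Inf {r. admissible f r}"
proof -
  have "1 / measure \<mu> (sphere 0 1) * x \<le> 1 \<longleftrightarrow> x \<le> measure \<mu> (sphere 0 1)" for x
    using mass_pos by (simp add: pos_divide_le_eq)
  then show ?thesis by (simp only: orlicz_norm_def admissible_def)
qed

lemma admissible_cong:
  assumes "\<And>u. u \<in> sphere 0 1 \<Longrightarrow> f u = g u"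
  shows "admissible f r = admissible g r"
proof -
  have "(\<integral>u. \<phi> (f u / r) \<partial>\<mu>) = (\<integral>u. \<phi> (g u / r) \<partial>\<mu>)"
    using assms by (intro Bochner_Integration.integral_cong) auto
  then show ?thesis by (simp add: admissible_def)
qed

lemma orlicz_norm_le: "admissible f r \<Longrightarrow> orlicz_norm \<mu> \<phi> f \<le> r"
  unfolding orlicz_norm_eq by (rule cInf_lower) (auto simp: admissible_def intro!: bdd_belowI[of _ 0])

context
  fixes f :: "'a \<Rightarrow> real"
  assumes f: "continuous_on (sphere 0 1) f" "\<And>u. u \<in> sphere 0 1 \<Longrightarrow> 0 < f u"
begin

lemma admissible_mono:
  assumes "admissible f r" "r \<le> r'"
  shows "admissible f r'"
proof -
  have r: "0 < r" "0 < r'" using assms by (auto simp: admissible_def)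
  have "(\<integral>u. \<phi> (f u / r') \<partial>\<mu>) \<le> (\<integral>u. \<phi> (f u / r) \<partial>\<mu>)"
    using r f assms(2) by (intro integral_mono phi_integrable phi_mono divide_left_mono) (auto simp: less_imp_le)
  with assms r show ?thesis by (simp add: admissible_def)
qed

lemma admissible_upper_bound:
  assumes "0 < b" "\<And>u. u \<in> sphere 0 1 \<Longrightarrow> f u \<le> b"
  shows "admissible f b"
proof -
  have "(\<integral>u. \<phi> (f u / b) \<partial>\<mu>) \<le> (\<integral>u. 1 \<partial>\<mu>)"
  proof (intro integral_mono phi_integrable f assms)
    fix u assume u: "u \<in> space \<mu>"
    then have "\<phi> (f u / b) \<le> \<phi> 1" using f assms by (intro phi_mono) auto
    then show "\<phi> (f u / b) \<le> 1" by (simp add: phi_one)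
  qed auto
  with assms show ?thesis by (simp add: admissible_def)
qed

text \<open>For \<open>r < a\<close> the integrand is everywhere at least
  \<open>\<phi> (a / r)\<close>, which exceeds \<open>\<phi> 1 = 1\<close>. This keeps the norm
  positive, so that shrinking a body strictly decreases it.\<close>

lemma admissible_ge:
  assumes "admissible f r" "0 < a" "\<And>u. u \<in> sphere 0 1 \<Longrightarrow> a \<le> f u"
  shows "a \<le> r"
proof (rule ccontr)
  assume "\<not> a \<le> r"
  with assms have r: "0 < r" "r < a" by (auto simp: admissible_def)
  then have "1 < \<phi> (a / r)" using phi_strict_mono[of 1 "a / r"] by (simp add: phi_one)
  then have "1 * measure \<mu> (sphere 0 1) < \<phi> (a / r) * measure \<mu> (sphere 0 1)"
    using mass_pos by (intro mult_strict_right_mono)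
  also have "\<dots> = (\<integral>u. \<phi> (a / r) \<partial>\<mu>)" by simp
  also have "\<dots> \<le> (\<integral>u. \<phi> (f u / r) \<partial>\<mu>)"
    using r f assms by (intro integral_mono phi_integrable phi_mono divide_right_mono) auto
  finally show False using assms(1) by (simp add: admissible_def)
qed

text \<open>Admissible radii are closed upwards, so every radius strictly above the infimum is
  admissible. Later estimates take such a radius and let it decrease to the bound.\<close>

lemma admissible_if_orlicz_norm_less:
  assumes "orlicz_norm \<mu> \<phi> f < r"
  shows "admissible f r"
proof -
  obtain a b where "0 < a" "0 < b" "\<And>u. u \<in> sphere 0 1 \<Longrightarrow> a \<le> f u \<and> f u \<le> b" using sphere_bounds_pos[OF f] by blast
  then have "{r. admissible f r} \<noteq> {}" using admissible_upper_bound by blast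
  then obtain r' where "admissible f r'" "r' < r"
    using assms unfolding orlicz_norm_eq by (metis cInf_lessD mem_Collect_eq)
  then show ?thesis using admissible_mono by simp
qed

lemma orlicz_norm_pos: "0 < orlicz_norm \<mu> \<phi> f"
proof -
  obtain a b where ab: "0 < a" "0 < b" "\<And>u. u \<in> sphere 0 1 \<Longrightarrow> a \<le> f u \<and> f u \<le> b" using sphere_bounds_pos[OF f] by blast
  then have "{r. admissible f r} \<noteq> {}" using admissible_upper_bound by blast
  then have "a \<le> orlicz_norm \<mu> \<phi> f"
    unfolding orlicz_norm_eq using ab admissible_ge by (intro cInf_greatest) auto
  with ab show ?thesis by simp
qed

lemma orlicz_norm_scale_le:
  assumes s: "0 < s"
  shows "orlicz_norm \<mu> \<phi> (\<lambda>u. s * f u) \<le> s * orlicz_norm \<mu> \<phi> f"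
proof -
  have "orlicz_norm \<mu> \<phi> (\<lambda>u. s * f u) / s \<le> r" if "orlicz_norm \<mu> \<phi> f < r" for r
  proof -
    have "admissible f r" using that by (rule admissible_if_orlicz_norm_less)
    then have "admissible (\<lambda>u. s * f u) (s * r)" using s by (simp add: admissible_def)
    then have "orlicz_norm \<mu> \<phi> (\<lambda>u. s * f u) \<le> s * r" by (rule orlicz_norm_le)
    with s show ?thesis by (simp add: pos_divide_le_eq mult.commute)
  qed
  then have "orlicz_norm \<mu> \<phi> (\<lambda>u. s * f u) / s \<le> orlicz_norm \<mu> \<phi> f" by (rule dense_ge)
  with s show ?thesis by (simp add: pos_divide_le_eq mult.commute)
qed

end

text \<open>Any \<open>r > m\<close> is admissible for both functions at once; pointwise convexity
  of \<open>\<phi>\<close> then bounds the integral for the mean by the average of the two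
  integrals.\<close>

lemma orlicz_norm_midpoint_le:
  assumes conv: "convex_on {0<..} \<phi>"
    and f: "continuous_on (sphere 0 1) f" "\<And>u. u \<in> sphere 0 1 \<Longrightarrow> 0 < f u" "orlicz_norm \<mu> \<phi> f \<le> m"
    and g: "continuous_on (sphere 0 1) g" "\<And>u. u \<in> sphere 0 1 \<Longrightarrow> 0 < g u" "orlicz_norm \<mu> \<phi> g \<le> m"
  shows "orlicz_norm \<mu> \<phi> (\<lambda>u. (f u + g u) / 2) \<le> m"
proof (rule dense_ge)
  fix r assume r: "m < r"
  have af: "admissible f r" and ag: "admissible g r"
    using r f g by (auto intro: admissible_if_orlicz_norm_less)
  then have r0: "0 < r" by (simp add: admissible_def)
  have int: "integrable \<mu> (\<lambda>u. \<phi> (f u / r))" "integrable \<mu> (\<lambda>u. \<phi> (g u / r))"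
    using f g r0 by (auto intro: phi_integrable)
  have "(\<integral>u. \<phi> ((f u + g u) / 2 / r) \<partial>\<mu>) \<le> (\<integral>u. 1/2 * \<phi> (f u / r) + 1/2 * \<phi> (g u / r) \<partial>\<mu>)"
  proof (rule integral_mono)
    show "integrable \<mu> (\<lambda>u. \<phi> ((f u + g u) / 2 / r))"
      using f g r0 by (intro phi_integrable continuous_on_divide continuous_on_add continuous_on_const)
        (auto intro: add_pos_pos)
    show "integrable \<mu> (\<lambda>u. 1/2 * \<phi> (f u / r) + 1/2 * \<phi> (g u / r))" using int by simp
    fix u assume "u \<in> space \<mu>"
    then have u: "u \<in> sphere 0 1" by simp
    have "(f u + g u) / 2 / r = (1 - 1/2) *\<^sub>R (f u / r) + (1/2) *\<^sub>R (g u / r)"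
      using r0 by (simp add: field_simps)
    moreover have "\<phi> ((1 - 1/2) *\<^sub>R (f u / r) + (1/2) *\<^sub>R (g u / r))
        \<le> (1 - 1/2) * \<phi> (f u / r) + (1/2) * \<phi> (g u / r)"
      using f(2)[OF u] g(2)[OF u] r0 by (intro convex_onD[OF conv]) auto
    ultimately show "\<phi> ((f u + g u) / 2 / r) \<le> 1/2 * \<phi> (f u / r) + 1/2 * \<phi> (g u / r)" by simp
  qed
  also have "\<dots> = 1/2 * (\<integral>u. \<phi> (f u / r) \<partial>\<mu>) + 1/2 * (\<integral>u. \<phi> (g u / r) \<partial>\<mu>)"
    using int by simp
  also have "\<dots> \<le> measure \<mu> (sphere 0 1)" using af ag by (simp add: admissible_def)
  finally have "admissible (\<lambda>u. (f u + g u) / 2) r" using r0 by (simp add: admissible_def)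
  then show "orlicz_norm \<mu> \<phi> (\<lambda>u. (f u + g u) / 2) \<le> r" by (rule orlicz_norm_le)
qed

text \<open>A compactness argument. If no uniform bound existed, directions whose caps have
  vanishing height and vanishing mass would accumulate at some \<open>w\<close>. Some cap about
  \<open>w\<close> has positive mass and is contained in caps about all nearby directions.\<close>

lemma caps_uniform:
  "\<exists>\<alpha> c. 0 < \<alpha> \<and> 0 < c \<and> (\<forall>v\<in>sphere 0 1. c \<le> measure \<mu> {u \<in> sphere 0 1. \<alpha> \<le> u \<bullet> v})"
proof (rule ccontr)
  have meas: "{u \<in> sphere 0 1. \<alpha> \<le> u \<bullet> v} \<in> sets \<mu>" for \<alpha> v
  proof (rule sets_finite_borel_measure_on_sphere[OF borel_mu])
    have "{u \<in> sphere 0 1. \<alpha> \<le> u \<bullet> v} = sphere 0 1 \<inter> {u. v \<bullet> u \<ge> \<alpha>}" by (auto simp: inner_commute)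
    then show "{u \<in> sphere 0 1. \<alpha> \<le> u \<bullet> v} \<in> sets borel"
      using closed_Int[OF closed_sphere closed_halfspace_ge] by (metis borel_closed)
  qed auto
  assume neg: "\<not> ?thesis"
  have "\<exists>v\<in>sphere 0 1. measure \<mu> {u \<in> sphere 0 1. inverse (real (Suc k)) \<le> u \<bullet> v} < inverse (real (Suc k))" for k
  proof (rule ccontr)
    assume "\<not> ?thesis"
    then have "\<forall>v\<in>sphere 0 1. inverse (real (Suc k)) \<le> measure \<mu> {u \<in> sphere 0 1. inverse (real (Suc k)) \<le> u \<bullet> v}"
      by (simp add: not_less)
    moreover have "0 < inverse (real (Suc k))" by simp
    ultimately show False using neg by blast
  qed
  then obtain v where v: "\<And>k. v k \<in> sphere 0 1"
    "\<And>k. measure \<mu> {u \<in> sphere 0 1. inverse (real (Suc k)) \<le> u \<bullet> v k} < inverse (real (Suc k))"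
    by metis
  then obtain w r where w: "w \<in> sphere 0 1" and r: "strict_mono (r::nat \<Rightarrow> nat)" "(v \<circ> r) \<longlonglongrightarrow> w"
    using compact_sphere[unfolded compact_def, of "0::'a" 1] by metis
  \<comment> \<open>The open hemisphere about \<open>w\<close> is the countable union of these caps,
    so they cannot all be null.\<close>
  have "\<exists>j. 0 < measure \<mu> {u \<in> sphere 0 1. 2 * inverse (real (Suc j)) \<le> u \<bullet> w}"
  proof (rule ccontr)
    assume "\<not> ?thesis"
    then have "emeasure \<mu> {u \<in> sphere 0 1. 2 * inverse (real (Suc j)) \<le> u \<bullet> w} = 0" for j
      by (simp add: mu.emeasure_eq_measure not_less measure_le_0_iff)
    then have "emeasure \<mu> (\<Union>j. {u \<in> sphere 0 1. 2 * inverse (real (Suc j)) \<le> u \<bullet> w}) = 0"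
      using meas by (intro emeasure_UN_eq_0) auto
    moreover have U: "(\<Union>j. {u \<in> sphere 0 1. 2 * inverse (real (Suc j)) \<le> u \<bullet> w}) \<in> sets \<mu>"
      using meas by (intro sets.countable_UN) auto
    moreover have sub: "{u \<in> sphere 0 1. 0 < u \<bullet> w} \<subseteq> (\<Union>j. {u \<in> sphere 0 1. 2 * inverse (real (Suc j)) \<le> u \<bullet> w})"
    proof
      fix u assume u: "u \<in> {u \<in> sphere 0 1. 0 < u \<bullet> w}"
      then obtain j where "inverse (real (Suc j)) < u \<bullet> w / 2"
        using reals_Archimedean[of "u \<bullet> w / 2"] by auto
      with u show "u \<in> (\<Union>j. {u \<in> sphere 0 1. 2 * inverse (real (Suc j)) \<le> u \<bullet> w})"
        by (auto intro!: exI[of _ j])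
    qed
    ultimately have "emeasure \<mu> {u \<in> sphere 0 1. 0 < u \<bullet> w} = 0"
      using emeasure_mono[OF sub U] by (simp only: le_zero_eq)
    then have "measure \<mu> {u \<in> sphere 0 1. 0 < u \<bullet> w} = 0" by (simp add: measure_def)
    moreover have "0 < measure \<mu> {u \<in> sphere 0 1. 0 < u \<bullet> w}"
      using not_concentrated w unfolding not_concentrated_on_closed_hemisphere_def by blast
    ultimately show False by simp
  qed
  then obtain j where j: "0 < measure \<mu> {u \<in> sphere 0 1. 2 * inverse (real (Suc j)) \<le> u \<bullet> w}" ..
  define c where "c = measure \<mu> {u \<in> sphere 0 1. 2 * inverse (real (Suc j)) \<le> u \<bullet> w}"
  \<comment> \<open>The cap about \<open>w\<close> has height \<open>2 * \<alpha>\<close>; one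
    \<open>\<alpha>\<close> is spent on moving its centre to \<open>v (r k)\<close>.\<close>
  define \<alpha> where "\<alpha> = inverse (real (Suc j))"
  have pos: "0 < c" "0 < \<alpha>" using j by (auto simp: c_def \<alpha>_def)
  have "eventually (\<lambda>k. dist ((v \<circ> r) k) w < \<alpha>) sequentially"
    using r(2) pos by (simp add: tendsto_iff)
  moreover have "eventually (\<lambda>k. inverse (real (Suc (r k))) < min c \<alpha>) sequentially"
  proof -
    have "(\<lambda>k. inverse (real (Suc (r k)))) \<longlonglongrightarrow> 0"
      using LIMSEQ_subseq_LIMSEQ[OF LIMSEQ_inverse_real_of_nat r(1)] by (simp add: o_def)
    then show ?thesis using pos by (intro order_tendstoD(2)) auto
  qed
  ultimately have "eventually (\<lambda>k. dist ((v \<circ> r) k) w < \<alpha> \<and> inverse (real (Suc (r k))) < min c \<alpha>) sequentially"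
    by (rule eventually_conj)
  then obtain k where k: "dist (v (r k)) w < \<alpha>" "inverse (real (Suc (r k))) < min c \<alpha>"
    by (auto simp: eventually_sequentially)
  have "c \<le> measure \<mu> {u \<in> sphere 0 1. inverse (real (Suc (r k))) \<le> u \<bullet> v (r k)}"
    unfolding c_def
  proof (rule mu.finite_measure_mono[OF _ meas], safe)
    fix u :: 'a assume u: "u \<in> sphere 0 1" "2 * inverse (real (Suc j)) \<le> u \<bullet> w"
    have "u \<bullet> (w - v (r k)) \<le> norm u * norm (w - v (r k))" by (rule norm_cauchy_schwarz)
    also have "\<dots> \<le> \<alpha>" using u k by (simp add: dist_norm norm_minus_commute)
    finally have "\<alpha> \<le> u \<bullet> v (r k)" using u by (simp add: inner_diff_right \<alpha>_def)
    then show "inverse (real (Suc (r k))) \<le> u \<bullet> v (r k)" using k by linarith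
  qed
  with v(2)[of "r k"] k show False by simp
qed

text \<open>A point \<open>x\<close> of \<open>Q\<close> forces the support function to be at least
  \<open>norm x * \<alpha>\<close> on the cap about the direction of \<open>x\<close>. Every such
  cap has mass at least \<open>c\<close>, so for large \<open>norm x\<close> the integral exceeds
  the total mass, as \<open>\<phi>\<close> is unbounded.\<close>

lemma orlicz_norm_less_imp_bounded:
  assumes l: "0 < l"
  shows "\<exists>R>0. \<forall>Q\<in>convex_bodies_o. orlicz_norm \<mu> \<phi> (support_function Q) < l \<longrightarrow> Q \<subseteq> cball 0 R"
proof -
  let ?m = "measure \<mu> (sphere 0 1)"
  obtain \<alpha> c where pos: "0 < \<alpha>" "0 < c" and caps: "\<And>v. v \<in> sphere 0 1 \<Longrightarrow> c \<le> measure \<mu> {u \<in> sphere 0 1. \<alpha> \<le> u \<bullet> v}"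
    using caps_uniform by blast
  have "filterlim \<phi> at_top at_top" using phi by (simp add: class_I_def)
  then have "eventually (\<lambda>t. ?m / c < \<phi> t) at_top" by (simp add: filterlim_at_top_dense)
  then obtain T where T: "\<And>t. T \<le> t \<Longrightarrow> ?m / c < \<phi> t" by (auto simp: eventually_at_top_linorder)
  define R where "R = max 1 (T * l / \<alpha>)"
  have "norm x \<le> R" if Q: "Q \<in> convex_bodies_o" and less: "orlicz_norm \<mu> \<phi> (support_function Q) < l" and x: "x \<in> Q" for Q x
  proof (rule ccontr)
    assume "\<not> norm x \<le> R"
    then have nx: "1 < norm x" "T * l / \<alpha> \<le> norm x" by (auto simp: R_def)
    then have "norm x \<noteq> 0" by linarith
    define v where "v = x /\<^sub>R norm x"
    have v: "v \<in> sphere 0 1" "x = norm x *\<^sub>R v" using \<open>norm x \<noteq> 0\<close> by (auto simp: v_def)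
    let ?h = "support_function Q"
    have h: "continuous_on (sphere 0 1) ?h" "\<And>u. u \<in> sphere 0 1 \<Longrightarrow> 0 < ?h u"
      using Q by (auto intro: continuous_on_support_function support_function_pos)
    have adm: "admissible ?h l" using h less by (rule admissible_if_orlicz_norm_less)
    let ?A = "{u \<in> sphere 0 1. \<alpha> \<le> u \<bullet> v}"
    have A: "?A \<in> sets \<mu>"
    proof (rule sets_finite_borel_measure_on_sphere[OF borel_mu])
      have "?A = sphere 0 1 \<inter> {u. v \<bullet> u \<ge> \<alpha>}" by (auto simp: inner_commute)
      then show "?A \<in> sets borel"
        using closed_Int[OF closed_sphere closed_halfspace_ge] by (metis borel_closed)
    qed auto
    let ?t = "norm x * \<alpha> / l"
    have "T * l \<le> norm x * \<alpha>" using nx pos by (simp add: pos_divide_le_eq)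
    then have "T \<le> ?t" using l by (simp add: pos_le_divide_eq)
    have t0: "0 < ?t" using nx pos l by (intro divide_pos_pos mult_pos_pos) auto
    have "?m / c < \<phi> ?t" using T[OF \<open>T \<le> ?t\<close>] .
    then have "?m < \<phi> ?t * c" using pos by (simp add: pos_divide_less_eq)
    also have "\<dots> \<le> \<phi> ?t * measure \<mu> ?A"
      using caps[OF v(1)] phi_pos[OF t0] by (intro mult_left_mono) auto
    also have "\<dots> = (\<integral>u. \<phi> ?t * indicator ?A u \<partial>\<mu>)"
    proof -
      have "?A \<inter> sphere 0 1 = ?A" by blast
      with A show ?thesis by simp
    qed
    also have "\<dots> \<le> (\<integral>u. \<phi> (?h u / l) \<partial>\<mu>)"
    proof (intro integral_mono phi_integrable h l)
      show "integrable \<mu> (\<lambda>u. \<phi> ?t * indicator ?A u)"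
        using A by (intro integrable_mult_right integrable_real_indicator) (auto simp: less_top[symmetric])
      fix u assume "u \<in> space \<mu>"
      then have u: "u \<in> sphere 0 1" by simp
      show "\<phi> ?t * indicator ?A u \<le> \<phi> (?h u / l)"
      proof (cases "u \<in> ?A")
        case True
        have "norm x * \<alpha> \<le> norm x * (u \<bullet> v)" using True nx by (intro mult_left_mono) auto
        also have "\<dots> = x \<bullet> u" by (subst v(2)) (simp add: inner_commute)
        also have "\<dots> \<le> ?h u" using Q x by (intro support_function_ge) (auto simp: convex_bodies_o_def)
        finally have "\<phi> ?t \<le> \<phi> (?h u / l)" using t0 l by (intro phi_mono divide_right_mono) auto
        with True show ?thesis by simp
      next
        case False
        have "0 < \<phi> (?h u / l)" using h(2)[OF u] l by (intro phi_pos) simp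
        with False show ?thesis by simp
      qed
    qed
    finally show False using adm by (simp add: admissible_def)
  qed
  then show ?thesis by (intro exI[of _ R]) (auto simp: R_def)
qed

end

section \<open>Existence and uniqueness of minimizers\<close>

context radial_weight
begin

lemma dual_volume_polar_body:
  assumes "Q \<in> convex_bodies_o"
  shows "dual_volume G (polar_body Q) = weight_integral (support_function Q)"
  unfolding dual_volume_def weight_integral_def
  using assms
  by (intro Bochner_Integration.integral_cong) (auto simp: radial_function_polar_body)

lemma dual_volume_cball: "dual_volume G (cball 0 1) = weight_integral (\<lambda>_. 1)"
  unfolding dual_volume_def weight_integral_def
  by (intro Bochner_Integration.integral_cong) (auto simp: radial_function_cball)

lemma dual_volume_class_eq:
  "dual_volume_class G = {Q \<in> convex_bodies_o. weight_integral (support_function Q) = weight_integral (\<lambda>_. 1)}"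
  by (auto simp: dual_volume_class_def dual_volume_polar_body dual_volume_cball)

lemma weight_integral_cong:
  assumes "\<And>u. u \<in> sphere 0 1 \<Longrightarrow> f u = g u"
  shows "weight_integral f = weight_integral g"
  unfolding weight_integral_def
  using assms
  by (intro Bochner_Integration.integral_cong) auto

text \<open>The unit ball is its own polar. Its membership makes the infimum one over a nonempty
  set.\<close>

lemma cball_in_dual_volume_class: "cball 0 1 \<in> dual_volume_class G"
  using weight_integral_cong[of "support_function (cball 0 1)" "\<lambda>_. 1"]
  by (simp add: dual_volume_class_eq cball_in_convex_bodies_o support_function_cball)

lemma weight_integral_scale_continuous:
  assumes f: "continuous_on (sphere 0 1) f" "\<And>u. u \<in> sphere 0 1 \<Longrightarrow> 0 < f u" and a: "0 < a"
  shows "continuous_on {a..b} (\<lambda>r. weight_integral (\<lambda>u. r * f u))"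
  unfolding continuous_on_sequentially o_def
proof safe
  fix x r assume x: "\<forall>n. x n \<in> {a..b}" "r \<in> {a..b}" "x \<longlonglongrightarrow> r"
  obtain p q where pq: "0 < p" "0 < q" "\<And>u. u \<in> sphere 0 1 \<Longrightarrow> p \<le> f u \<and> f u \<le> q"
    using sphere_bounds_pos[OF f] by blast
  show "(\<lambda>n. weight_integral (\<lambda>u. x n * f u)) \<longlonglongrightarrow> weight_integral (\<lambda>u. r * f u)"
  proof (rule weight_integral_tendsto)
    show "0 < a * p" using a pq by simp
    fix n u assume "u \<in> sphere (0::'a) 1"
    then have "p \<le> f u" "f u \<le> q" using pq by auto
    moreover have "a \<le> x n" "x n \<le> b" using x by auto
    ultimately show "a * p \<le> x n * f u \<and> x n * f u \<le> b * q"
      using a pq(1) by (intro conjI mult_mono) auto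
  qed (use f x in \<open>auto intro!: continuous_intros tendsto_intros\<close>)
qed

lemma weight_integral_scale_root:
  assumes f: "continuous_on (sphere 0 1) f" "\<And>u. u \<in> sphere 0 1 \<Longrightarrow> 0 < f u"
    and ab: "0 < a" "a \<le> b"
    and V: "weight_integral (\<lambda>u. b * f u) \<le> V" "V \<le> weight_integral (\<lambda>u. a * f u)"
  shows "\<exists>r. a \<le> r \<and> r \<le> b \<and> weight_integral (\<lambda>u. r * f u) = V"
  using IVT2'[OF V ab(2) weight_integral_scale_continuous[OF f ab(1)]] .

lemma weight_integral_strict_antimono:
  assumes f: "continuous_on (sphere 0 1) f" "\<And>u. u \<in> sphere 0 1 \<Longrightarrow> 0 < f u"
    and g: "continuous_on (sphere 0 1) g" "\<And>u. u \<in> sphere 0 1 \<Longrightarrow> f u < g u"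
  shows "weight_integral g < weight_integral f"
proof -
  have g0: "0 < g u" if "u \<in> sphere 0 1" for u using f(2)[OF that] g(2)[OF that] by linarith
  have less: "G (1 / g u) u < G (1 / f u) u" if "u \<in> sphere 0 1" for u
    using strict_mono_onD[OF weight_mono[OF that], of "1 / g u" "1 / f u"] f(2)[OF that] g(2)[OF that] g0[OF that]
    by (simp add: frac_less2)
  obtain v :: 'a where v: "v \<in> sphere 0 1" using vector_choose_size[of 1] by auto
  have "0 < (\<integral>u. G (1 / f u) u - G (1 / g u) u \<partial>spherical_measure)"
    using f g g0 less less[OF v]
    by (intro integral_spherical_measure_pos[OF dim _ _ v] continuous_on_diff weight_integrable(1)) (auto intro: less_imp_le)
  then show ?thesis
    unfolding weight_integral_def
    using weight_integrable(2)[OF f] weight_integrable(2)[OF g(1) g0] by simp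
qed

lemma weight_integral_midpoint_less:
  assumes conv: "\<And>u. u \<in> sphere 0 1 \<Longrightarrow> convex_on {0<..} (\<lambda>t. G t u)"
    and f: "continuous_on (sphere 0 1) f" "\<And>u. u \<in> sphere 0 1 \<Longrightarrow> 0 < f u"
    and g: "continuous_on (sphere 0 1) g" "\<And>u. u \<in> sphere 0 1 \<Longrightarrow> 0 < g u"
    and v: "v \<in> sphere 0 1" "f v \<noteq> g v"
    and V: "weight_integral f \<le> V" "weight_integral g \<le> V"
  shows "weight_integral (\<lambda>u. (f u + g u) / 2) < V"
proof -
  have mean: "2 / (x + y) \<le> (1/2) * (1 / x) + (1/2) * (1 / y)"
    "x \<noteq> y \<Longrightarrow> 2 / (x + y) < (1/2) * (1 / x) + (1/2) * (1 / y)" if "0 < x" "0 < y" for x y :: real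
  proof -
    \<comment> \<open>The gap between the mean of the reciprocals and the reciprocal of the mean, in
      closed form; its sign and its zeros are visible.\<close>
    have *: "(1/2) * (1 / x) + (1/2) * (1 / y) - 2 / (x + y) = (x - y)\<^sup>2 / (2 * x * y * (x + y))"
      using that by (simp add: field_simps power2_eq_square)
    have "0 \<le> (x - y)\<^sup>2 / (2 * x * y * (x + y))" using that by simp
    with * show "2 / (x + y) \<le> (1/2) * (1 / x) + (1/2) * (1 / y)" by linarith
    assume "x \<noteq> y"
    then have "0 < (x - y)\<^sup>2 / (2 * x * y * (x + y))" using that by simp
    with * show "2 / (x + y) < (1/2) * (1 / x) + (1/2) * (1 / y)" by linarith
  qed
  let ?m = "\<lambda>u. (1/2) * (1 / f u) + (1/2) * (1 / g u)"
  \<comment> \<open>\<open>D\<close> collects the loss from convexity of \<open>G\<close> and the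
    loss from the two means. It is known to be positive only at \<open>v\<close>; its continuity
    makes the integral positive.\<close>
  define D where "D u = (1/2) * G (1 / f u) u + (1/2) * G (1 / g u) u - G (1 / ((f u + g u) / 2)) u" for u
  have conv': "G (?m u) u \<le> (1/2) * G (1 / f u) u + (1/2) * G (1 / g u) u" if u: "u \<in> sphere 0 1" for u
    using convex_onD[OF conv[OF u], of "1/2" "1 / f u" "1 / g u"] f(2)[OF u] g(2)[OF u] by simp
  have D: "0 \<le> D u" if u: "u \<in> sphere 0 1" for u
  proof -
    have "G (1 / ((f u + g u) / 2)) u \<le> G (?m u) u"
      using mean(1)[OF f(2)[OF u] g(2)[OF u]] f(2)[OF u] g(2)[OF u] u by (intro weight_le) (auto simp: add_pos_pos)
    with conv'[OF u] show ?thesis by (simp add: D_def)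
  qed
  have "0 < D v"
  proof -
    have "G (1 / ((f v + g v) / 2)) v < G (?m v) v"
      using mean(2)[OF f(2)[OF v(1)] g(2)[OF v(1)] v(2)] f(2)[OF v(1)] g(2)[OF v(1)]
      by (intro strict_mono_onD[OF weight_mono[OF v(1)]]) (auto simp: add_pos_pos)
    with conv'[OF v(1)] show ?thesis by (simp add: D_def)
  qed
  have h: "continuous_on (sphere 0 1) (\<lambda>u. (f u + g u) / 2)" "\<And>u. u \<in> sphere 0 1 \<Longrightarrow> 0 < (f u + g u) / 2"
    using f g by (auto intro!: continuous_intros simp: add_pos_pos)
  note cont = weight_integrable(1)[OF f] weight_integrable(1)[OF g] weight_integrable(1)[OF h]
  note int = weight_integrable(2)[OF f] weight_integrable(2)[OF g] weight_integrable(2)[OF h]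
  have "continuous_on (sphere 0 1) D"
    unfolding D_def by (intro continuous_on_diff continuous_on_add continuous_on_mult continuous_on_const cont)
  then have "0 < (\<integral>u. D u \<partial>spherical_measure)"
    using D \<open>0 < D v\<close> v by (intro integral_spherical_measure_pos[OF dim])
  also have "(\<integral>u. D u \<partial>spherical_measure)
      = (1/2) * weight_integral f + (1/2) * weight_integral g - weight_integral (\<lambda>u. (f u + g u) / 2)"
    unfolding D_def weight_integral_def using int by simp
  finally show ?thesis using V by simp
qed

end

section \<open>Minimizing the Orlicz norm under the dual volume constraint\<close>

locale dual_orlicz = radial_weight G + orlicz_data \<phi> \<mu>
  for G :: "real \<Rightarrow> 'a::euclidean_space \<Rightarrow> real" and \<phi> and \<mu> :: "'a measure"
begin

abbreviation "body_norm Q \<equiv> orlicz_norm \<mu> \<phi> (support_function Q)"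

lemma body_props:
  assumes "Q \<in> convex_bodies_o"
  shows "continuous_on (sphere 0 1) (support_function Q)" "\<And>u. u \<in> sphere 0 1 \<Longrightarrow> 0 < support_function Q u"
  using assms by (auto intro: continuous_on_support_function support_function_pos)

lemma body_norm_bdd_below: "bdd_below (body_norm ` dual_volume_class G)"
  using orlicz_norm_pos[OF body_props] less_imp_le
  by (intro bdd_belowI[of _ 0]) (auto simp: dual_volume_class_def)

lemma INF_body_norm_le: "Q \<in> dual_volume_class G \<Longrightarrow> (INF Q\<in>dual_volume_class G. body_norm Q) \<le> body_norm Q"
  by (rule cINF_lower[OF body_norm_bdd_below])

lemma minimizer_exists:
  "\<exists>M\<in>dual_volume_class G. body_norm M = (INF Q\<in>dual_volume_class G. body_norm Q)"
proof -
  let ?I = "INF Q\<in>dual_volume_class G. body_norm Q"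
  have ne: "dual_volume_class G \<noteq> {}" using cball_in_dual_volume_class by blast
  have "\<exists>Q\<in>dual_volume_class G. body_norm Q < ?I + inverse (real (Suc k))" for k
    using cINF_less_iff[OF ne body_norm_bdd_below, of "?I + inverse (real (Suc k))"] by simp
  then obtain Q where Q: "\<And>k. Q k \<in> dual_volume_class G" "\<And>k. body_norm (Q k) < ?I + inverse (real (Suc k))"
    by metis
  have Qc: "Q k \<in> convex_bodies_o" and QV: "weight_integral (support_function (Q k)) = weight_integral (\<lambda>_. 1)" for k
    using Q(1)[of k] by (auto simp: dual_volume_class_eq)
  have I0: "0 \<le> ?I"
    using ne orlicz_norm_pos[OF body_props] by (intro cINF_greatest) (auto simp: dual_volume_class_def less_imp_le)
  have "body_norm (Q k) < ?I + 1" for k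
    using Q(2)[of k] le_imp_inverse_le[of 1 "real (Suc k)"] by simp
  then obtain R where R: "0 < R" "\<And>k. Q k \<subseteq> cball 0 R"
    using orlicz_norm_less_imp_bounded[of "?I + 1"] I0 Qc by fastforce
  have Qp: "compact (Q k)" "Q k \<noteq> {}" for k using Qc[of k] by (auto elim: convex_bodies_oE)
  \<comment> \<open>Containment in \<open>cball 0 R\<close> makes all the support functions
    \<open>R\<close>-Lipschitz, so one \<open>\<epsilon>\<close> serves every
    \<open>k\<close>.\<close>
  obtain \<epsilon> where \<epsilon>: "0 < \<epsilon>" and low: "\<And>k u. u \<in> sphere 0 1 \<Longrightarrow> \<epsilon> \<le> support_function (Q k) u"
    using weight_integral_bounded_imp_inradius[OF R(1), of "weight_integral (\<lambda>_. 1)"]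
      body_props[OF Qc] support_function_lipschitz[OF Qp(1) R(2) Qp(2)] QV
    by (metis order_refl)
  have up: "support_function (Q k) u \<le> R" if "u \<in> sphere 0 1" for k u
    using support_function_le_radius[OF R(2) Qp(2)] that by simp
  obtain h r where h: "continuous_on (sphere 0 1) h" and r: "strict_mono (r :: nat \<Rightarrow> nat)"
    and unif: "\<And>e. 0 < e \<Longrightarrow> \<exists>N. \<forall>n x. n \<ge> N \<and> x \<in> sphere 0 1 \<longrightarrow> norm (support_function (Q (r n)) x - h x) < e"
  proof (rule Arzela_Ascoli[of "sphere 0 1" "\<lambda>k. support_function (Q k)" R])
    show "norm (support_function (Q n) x) \<le> R" if "x \<in> sphere 0 1" for n x
      using low[OF that, of n] up[OF that, of n] \<epsilon> by simp
    show "\<exists>d>0. \<forall>n y. y \<in> sphere 0 1 \<and> norm (x - y) < d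
        \<longrightarrow> norm (support_function (Q n) x - support_function (Q n) y) < e" if "0 < e" for x :: 'a and e
    proof (intro exI[of _ "e / R"] conjI allI impI)
      show "0 < e / R" using that R by simp
      fix n y assume "y \<in> sphere 0 1 \<and> norm (x - y) < e / R"
      then have "R * dist x y < e" using R by (simp add: dist_norm pos_less_divide_eq mult.commute)
      then show "norm (support_function (Q n) x - support_function (Q n) y) < e"
        using support_function_dist_le[OF Qp(1) R(2) Qp(2), of n x y] by simp
    qed
  qed auto
  have lim: "(\<lambda>k. support_function (Q (r k)) u) \<longlonglongrightarrow> h u" if "u \<in> sphere 0 1" for u
    using unif that by (intro LIMSEQ_I) blast
  have hlow: "\<epsilon> \<le> h u" if "u \<in> sphere 0 1" for u
    using lim[OF that] low[OF that] by (intro LIMSEQ_le_const) auto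
  obtain M where M: "M \<in> convex_bodies_o" and Mh: "\<And>u. norm u = 1 \<Longrightarrow> support_function M u = h u"
    using support_function_limit_body[of "\<lambda>k. Q (r k)" R h \<epsilon>] Qc R(2) lim \<epsilon> hlow by auto
  have "(\<lambda>k. weight_integral (support_function (Q (r k)))) \<longlonglongrightarrow> weight_integral h"
    using low up \<epsilon> lim h body_props(1)[OF Qc]
    by (intro weight_integral_tendsto[where a = \<epsilon> and b = R]) auto
  then have "weight_integral h = weight_integral (\<lambda>_. 1)"
    by (simp add: QV LIMSEQ_const_iff)
  moreover have "weight_integral (support_function M) = weight_integral h"
    using Mh by (intro weight_integral_cong) simp
  ultimately have MV: "M \<in> dual_volume_class G" using M by (simp add: dual_volume_class_eq)
  \<comment> \<open>For \<open>l\<close> strictly above the infimum, the bodies of the subsequence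
    eventually have norm below \<open>l\<close>, so \<open>l\<close> is admissible for them. This
    integral inequality passes to the limit.\<close>
  have "body_norm M \<le> ?I"
  proof (rule dense_ge)
    fix l assume l: "?I < l"
    then have l0: "0 < l" using I0 by simp
    have "(\<lambda>k. \<integral>u. \<phi> (support_function (Q (r k)) u / l) \<partial>\<mu>) \<longlonglongrightarrow> (\<integral>u. \<phi> (h u / l) \<partial>\<mu>)"
    proof (rule integral_weight_tendsto[OF borel_mu continuous_phi_weight,
          where f = "\<lambda>k u. support_function (Q (r k)) u / l" and g = "\<lambda>u. h u / l" and a = "\<epsilon> / l" and b = "R / l"])
      show "0 < \<epsilon> / l" using \<epsilon> l0 by simp
      show "\<epsilon> / l \<le> support_function (Q (r k)) u / l \<and> support_function (Q (r k)) u / l \<le> R / l"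
        if "u \<in> sphere 0 1" for k u
        using low[OF that] up[OF that] l0 by (auto intro!: divide_right_mono)
      show "(\<lambda>k. support_function (Q (r k)) u / l) \<longlonglongrightarrow> h u / l" if "u \<in> sphere 0 1" for u
        using l0 by (intro tendsto_intros lim that) auto
    qed (use l0 h body_props(1)[OF Qc] in \<open>auto intro!: continuous_on_divide\<close>)
    moreover have "eventually (\<lambda>k. (\<integral>u. \<phi> (support_function (Q (r k)) u / l) \<partial>\<mu>) \<le> measure \<mu> (sphere 0 1)) sequentially"
    proof -
      have "(\<lambda>k. inverse (real (Suc (r k)))) \<longlonglongrightarrow> 0"
        using LIMSEQ_subseq_LIMSEQ[OF LIMSEQ_inverse_real_of_nat r] by (simp add: o_def)
      then have "eventually (\<lambda>k. inverse (real (Suc (r k))) < l - ?I) sequentially"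
        using l by (intro order_tendstoD(2)) auto
      then show ?thesis
      proof eventually_elim
        case (elim k)
        then have "body_norm (Q (r k)) < l" using Q(2)[of "r k"] by linarith
        then show ?case
          using admissible_if_orlicz_norm_less[OF body_props[OF Qc]] by (auto simp: admissible_def)
      qed
    qed
    ultimately have "(\<integral>u. \<phi> (h u / l) \<partial>\<mu>) \<le> measure \<mu> (sphere 0 1)"
      by (intro tendsto_upperbound) auto
    then have "admissible h l" using l0 by (simp add: admissible_def)
    then have "admissible (support_function M) l" using Mh by (subst admissible_cong[of _ h]) auto
    then show "body_norm M \<le> l" by (rule orlicz_norm_le)
  qed
  with INF_body_norm_le[OF MV] have "body_norm M = ?I" by simp
  with MV show ?thesis by blast
qed

lemma minimizer_unique:
  assumes conv_phi: "convex_on {0<..} \<phi>" and conv: "\<And>u. u \<in> sphere 0 1 \<Longrightarrow> convex_on {0<..} (\<lambda>t. G t u)"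
    and M1: "M1 \<in> dual_volume_class G" "body_norm M1 = (INF Q\<in>dual_volume_class G. body_norm Q)"
    and M2: "M2 \<in> dual_volume_class G" "body_norm M2 = (INF Q\<in>dual_volume_class G. body_norm Q)"
  shows "M1 = M2"
proof (rule ccontr)
  assume neq: "M1 \<noteq> M2"
  let ?I = "INF Q\<in>dual_volume_class G. body_norm Q" and ?V = "weight_integral (\<lambda>_. 1)"
  define f where "f = support_function M1"
  define g where "g = support_function M2"
  have C: "M1 \<in> convex_bodies_o" "M2 \<in> convex_bodies_o" and V: "weight_integral f = ?V" "weight_integral g = ?V"
    using M1 M2 by (auto simp: dual_volume_class_eq f_def g_def)
  have f: "continuous_on (sphere 0 1) f" "\<And>u. u \<in> sphere 0 1 \<Longrightarrow> 0 < f u"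
    and g: "continuous_on (sphere 0 1) g" "\<And>u. u \<in> sphere 0 1 \<Longrightarrow> 0 < g u"
    using body_props C by (auto simp: f_def g_def)
  obtain v where v: "v \<in> sphere 0 1" "f v \<noteq> g v"
    using neq subset_if_support_function_le[OF C] subset_if_support_function_le[OF C(2,1)]
    unfolding f_def g_def by fastforce
  define H where "H u = (f u + g u) / 2" for u
  have H: "continuous_on (sphere 0 1) H" "\<And>u. u \<in> sphere 0 1 \<Longrightarrow> 0 < H u"
    using f g by (auto simp: H_def add_pos_pos intro!: continuous_intros)
  have VH: "weight_integral H < ?V"
    unfolding H_def using weight_integral_midpoint_less[OF conv f g v] V by simp
  have NH: "orlicz_norm \<mu> \<phi> H \<le> ?I"
    unfolding H_def using M1(2) M2(2)
    by (intro orlicz_norm_midpoint_le conv_phi f g) (auto simp: f_def g_def)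
  obtain a b where ab: "0 < a" "0 < b" "\<forall>u\<in>sphere 0 1. a \<le> H u \<and> H u \<le> b"
    using sphere_bounds_pos[OF H] by blast
  \<comment> \<open>Scaling \<open>H\<close> by this factor brings it below 1, which lifts its
    integral to at least that of the ball; at scale 1 the integral is too small. The intermediate
    value theorem gives a scale in between that meets the constraint, and it differs from 1.\<close>
  let ?s = "min 1 (1 / b)"
  have "?V \<le> weight_integral (\<lambda>u. ?s * H u)"
  proof (rule weight_integral_antimono)
    fix u :: 'a assume u: "u \<in> sphere 0 1"
    have "?s * H u \<le> (1 / b) * b" using ab H(2)[OF u] u by (intro mult_mono) auto
    with ab show "?s * H u \<le> 1" by simp
    show "0 < ?s * H u" using ab H(2)[OF u] by simp
  qed (intro continuous_intros H)+
  moreover have "weight_integral (\<lambda>u. 1 * H u) \<le> ?V" using VH by simp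
  ultimately obtain s where s: "?s \<le> s" "s \<le> 1" "weight_integral (\<lambda>u. s * H u) = ?V"
    using weight_integral_scale_root[OF H, of ?s 1 ?V] ab by auto
  have "s \<noteq> 1" using s(3) VH by auto
  moreover have "0 < ?s" using ab by simp
  ultimately have s': "0 < s" "s < 1" using s by linarith+
  obtain Q where Q: "Q \<in> convex_bodies_o" "\<And>u. support_function Q u = s / 2 * (f u + g u)"
    using minkowski_combination[OF C, of "s / 2"] s' unfolding f_def g_def by auto
  have hQ: "support_function Q = (\<lambda>u. s * H u)" using Q(2) by (auto simp: H_def)
  have "Q \<in> dual_volume_class G" using Q(1) s(3) by (simp add: dual_volume_class_eq hQ)
  then have "?I \<le> orlicz_norm \<mu> \<phi> (\<lambda>u. s * H u)" using INF_body_norm_le[of Q] by (simp add: hQ)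
  also have "\<dots> \<le> s * orlicz_norm \<mu> \<phi> H" using orlicz_norm_scale_le[OF H s'(1)] .
  also have "\<dots> < 1 * orlicz_norm \<mu> \<phi> H" using s' orlicz_norm_pos[OF H] by (intro mult_strict_right_mono)
  finally show False using NH by simp
qed

lemma minimizer_ex1:
  assumes "convex_on {0<..} \<phi>" "\<And>u. u \<in> sphere 0 1 \<Longrightarrow> convex_on {0<..} (\<lambda>t. G t u)"
  shows "\<exists>!M. M \<in> dual_volume_class G \<and> body_norm M = (INF Q\<in>dual_volume_class G. body_norm Q)"
proof (rule ex_ex1I)
  show "\<exists>M. M \<in> dual_volume_class G \<and> body_norm M = (INF Q\<in>dual_volume_class G. body_norm Q)"
    using minimizer_exists by blast
qed (use minimizer_unique[OF assms] in blast)

end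

section \<open>The homogeneous dual volume\<close>

context radial_weight
begin

text \<open>For large factors the integral tends to 0 by dominated convergence, with the integrand
  at factor 1 as majorant. For small factors the growth condition makes it exceed \<open>V\<close>,
  and continuity in the factor closes the gap.\<close>

lemma weight_integral_scale_surj:
  assumes lim: "\<And>u. u \<in> sphere 0 1 \<Longrightarrow> ((\<lambda>t. G t u) \<longlongrightarrow> 0) (at_right 0)"
    and f: "continuous_on (sphere 0 1) f" "\<And>u. u \<in> sphere 0 1 \<Longrightarrow> 0 < f u" and V: "0 < V"
  shows "\<exists>r>0. weight_integral (\<lambda>u. r * f u) = V"
proof -
  let ?\<sigma> = "spherical_measure :: 'a measure"
  have M: "finite_borel_measure_on_sphere ?\<sigma>" by (rule finite_borel_measure_spherical_measure)
  interpret finite_measure ?\<sigma> using M by (simp add: finite_borel_measure_on_sphere_def)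
  have scaled: "continuous_on (sphere 0 1) (\<lambda>u. r * f u)" "\<And>u. u \<in> sphere 0 1 \<Longrightarrow> 0 < r * f u" if "0 < r" for r
    using f that by (auto intro!: continuous_intros)
  have mono: "weight_integral (\<lambda>u. r' * f u) \<le> weight_integral (\<lambda>u. r * f u)" if "0 < r" "r \<le> r'" for r r'
    using scaled f that by (intro weight_integral_antimono mult_right_mono) (auto simp: less_imp_le)
  have "(\<lambda>k. \<integral>u. G (1 / (real (Suc k) * f u)) u \<partial>?\<sigma>) \<longlonglongrightarrow> (\<integral>u. 0 \<partial>?\<sigma>)"
  proof (rule integral_dominated_convergence[where w = "\<lambda>u. G (1 / f u) u"])
    show "integrable ?\<sigma> (\<lambda>u. G (1 / f u) u)" using f by (rule weight_integrable)
    show "(\<lambda>u. G (1 / (real (Suc k) * f u)) u) \<in> borel_measurable ?\<sigma>" for k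
      using weight_integrable(2)[OF scaled[of "real (Suc k)"]] by simp
    show "AE u in ?\<sigma>. norm (G (1 / (real (Suc k) * f u)) u) \<le> G (1 / f u) u" for k
    proof (rule AE_I2)
      fix u assume "u \<in> space ?\<sigma>"
      then have u: "u \<in> sphere 0 1" by simp
      have "f u \<le> real (Suc k) * f u" using f(2)[OF u] by simp
      then have "G (1 / (real (Suc k) * f u)) u \<le> G (1 / f u) u"
        using f(2)[OF u] u by (intro weight_le frac_le) (auto simp del: of_nat_Suc)
      then show "norm (G (1 / (real (Suc k) * f u)) u) \<le> G (1 / f u) u"
        using weight_pos[of "1 / (real (Suc k) * f u)" u] f(2)[OF u] u by (simp del: of_nat_Suc)
    qed
    show "AE u in ?\<sigma>. (\<lambda>k. G (1 / (real (Suc k) * f u)) u) \<longlonglongrightarrow> 0"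
    proof (rule AE_I2)
      fix u assume "u \<in> space ?\<sigma>"
      then have u: "u \<in> sphere 0 1" by simp
      have "(\<lambda>k. inverse (real (Suc k)) * (1 / f u)) \<longlonglongrightarrow> 0 * (1 / f u)"
        by (intro tendsto_mult LIMSEQ_inverse_real_of_nat tendsto_const)
      then have "(\<lambda>k. 1 / (real (Suc k) * f u)) \<longlonglongrightarrow> 0"
        by (simp add: inverse_eq_divide del: of_nat_Suc)
      then have "filterlim (\<lambda>k. 1 / (real (Suc k) * f u)) (at_right 0) sequentially"
        using f(2)[OF u] by (intro tendsto_imp_filterlim_at_right) (auto simp del: of_nat_Suc)
      from filterlim_compose[OF lim[OF u] this]
      show "(\<lambda>k. G (1 / (real (Suc k) * f u)) u) \<longlonglongrightarrow> 0" .
    qed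
  qed simp
  then have "eventually (\<lambda>k. (\<integral>u. G (1 / (real (Suc k) * f u)) u \<partial>?\<sigma>) < V) sequentially"
    using V by (intro order_tendstoD(2)) auto
  then obtain k where k: "weight_integral (\<lambda>u. real (Suc k) * f u) < V"
    unfolding weight_integral_def by (auto simp: eventually_sequentially)
  obtain v :: 'a where v: "v \<in> sphere 0 1" using vector_choose_size[of 1] by auto
  have mass: "0 < measure ?\<sigma> (sphere 0 1)"
    using integral_spherical_measure_pos[OF dim continuous_on_const _ v, of 1] by simp
  obtain p q where pq: "0 < q" "\<And>u. u \<in> sphere 0 1 \<Longrightarrow> f u \<le> q"
    using sphere_bounds_pos[OF f] by blast
  obtain c T where c: "0 < c" and T: "0 < T"
    and gr: "\<And>t u. T \<le> t \<Longrightarrow> u \<in> sphere 0 1 \<Longrightarrow> c * t ^ (DIM('a) - 1) \<le> G t u"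
    using growth by blast
  \<comment> \<open>The constant integrand \<open>c * t\<close> already integrates to at least
    \<open>V\<close>. With \<open>r = 1 / (t * q)\<close> every argument
    \<open>1 / (r * f u)\<close> is at least \<open>t\<close>, and \<open>t \<ge> 1\<close> reduces
    the power in the growth bound to \<open>t\<close> itself.\<close>
  define t where "t = max 1 (max T (V / (c * measure ?\<sigma> (sphere 0 1))))"
  have t: "1 \<le> t" "T \<le> t" "V / (c * measure ?\<sigma> (sphere 0 1)) \<le> t" by (auto simp: t_def)
  define r where "r = 1 / (t * q)"
  have r: "0 < r" using t pq by (simp add: r_def)
  have "V \<le> weight_integral (\<lambda>u. r * f u)"
  proof -
    have "V \<le> c * t * measure ?\<sigma> (sphere 0 1)"
      using t(3) mass c by (simp add: pos_divide_le_eq mult_ac)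
    also have "\<dots> = (\<integral>u. c * t \<partial>?\<sigma>)" by simp
    also have "\<dots> \<le> weight_integral (\<lambda>u. r * f u)"
      unfolding weight_integral_def
    proof (intro integral_mono weight_integrable scaled r)
      fix u assume "u \<in> space ?\<sigma>"
      then have u: "u \<in> sphere 0 1" by simp
      have "c * t ^ 1 \<le> c * t ^ (DIM('a) - 1)"
        using t(1) c dim by (intro mult_left_mono power_increasing) auto
      also have "\<dots> \<le> G t u" using t(2) u by (rule gr)
      also have "\<dots> \<le> G (1 / (r * f u)) u"
        using t(1) u pq(1) pq(2)[OF u] f(2)[OF u]
        by (intro weight_le) (auto simp: r_def field_simps)
      finally show "c * t \<le> G (1 / (r * f u)) u" by simp
    qed auto
    finally show ?thesis .
  qed
  moreover define a where "a = min r (real (Suc k))"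
  have a: "0 < a" "a \<le> r" "a \<le> real (Suc k)" using r by (auto simp: a_def)
  moreover have "weight_integral (\<lambda>u. r * f u) \<le> weight_integral (\<lambda>u. a * f u)"
    using a by (intro mono)
  ultimately obtain s where "a \<le> s" "weight_integral (\<lambda>u. s * f u) = V"
    using weight_integral_scale_root[OF f a(1,3), of V] k by auto
  with a show ?thesis by (intro exI[of _ s]) auto
qed

text \<open>By strict monotonicity the set is the closed ray starting at the unique \<open>s\<close>
  where the integral equals 1. The infimum is thus characterised by an equation.\<close>

lemma Inf_scale_eq_iff:
  assumes lim: "\<And>u. u \<in> sphere 0 1 \<Longrightarrow> ((\<lambda>t. G t u) \<longlongrightarrow> 0) (at_right 0)"
    and f: "continuous_on (sphere 0 1) f" "\<And>u. u \<in> sphere 0 1 \<Longrightarrow> 0 < f u"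
  shows "0 < Inf {r. 0 < r \<and> weight_integral (\<lambda>u. r * f u) \<le> 1}" (is "0 < Inf ?S")
    and "0 < \<eta> \<Longrightarrow> Inf {r. 0 < r \<and> weight_integral (\<lambda>u. r * f u) \<le> 1} = \<eta> \<longleftrightarrow> weight_integral (\<lambda>u. \<eta> * f u) = 1"
proof -
  let ?J = "\<lambda>r. weight_integral (\<lambda>u. r * f u)"
  have anti: "?J r' < ?J r" if "0 < r" "r < r'" for r r'
    using f that by (intro weight_integral_strict_antimono) (auto intro!: continuous_intros)
  obtain s where s: "0 < s" "?J s = 1"
    using weight_integral_scale_surj[OF lim f, of 1] by auto
  have "?J r \<le> 1 \<longleftrightarrow> s \<le> r" if "0 < r" for r
    using anti[of r s] anti[of s r] that s by (cases r s rule: linorder_cases) auto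
  then have "?S = {s..}" using s(1) by auto
  then have I: "Inf ?S = s" by simp
  with s show "0 < Inf ?S" by simp
  show "Inf ?S = \<eta> \<longleftrightarrow> ?J \<eta> = 1" if "0 < \<eta>"
    unfolding I using anti[of \<eta> s] anti[of s \<eta>] that s by (cases \<eta> s rule: linorder_cases) auto
qed

text \<open>Dividing the radial function of the polar body by \<open>r\<close> amounts to
  multiplying the support function by \<open>r\<close>. The form \<open>r * 1\<close> lets the ball
  be treated as the constant function 1.\<close>

lemma dual_volume_rescaled:
  shows "Q \<in> convex_bodies_o \<Longrightarrow> dual_volume (\<lambda>t u. G (t / r) u) (polar_body Q) = weight_integral (\<lambda>u. r * support_function Q u)"
    and "dual_volume (\<lambda>t u. G (t / r) u) (cball 0 1) = weight_integral (\<lambda>u. r * 1)"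
  unfolding dual_volume_def weight_integral_def
  by (intro Bochner_Integration.integral_cong;
      simp add: radial_function_polar_body radial_function_cball mult.commute)+

lemma hom_dual_volume_eq_Inf:
  "hom_dual_volume G K = Inf {r. 0 < r \<and> dual_volume (\<lambda>t u. G (t / r) u) K \<le> 1}"
  by (simp add: hom_dual_volume_def dual_volume_def)

lemma hom_dual_volume_cball_pos:
  assumes "\<And>u. u \<in> sphere 0 1 \<Longrightarrow> ((\<lambda>t. G t u) \<longlongrightarrow> 0) (at_right 0)"
  shows "0 < hom_dual_volume G (cball 0 1)"
  unfolding hom_dual_volume_eq_Inf dual_volume_rescaled
  using assms by (intro Inf_scale_eq_iff(1)) auto

text \<open>With \<open>\<eta>\<close> the homogeneous volume of the ball, having homogeneous volume
  \<open>\<eta>\<close> means that the dual volume for the rescaled weight is 1. That is also the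
  value of the ball for this weight, so both classes impose the same equation.\<close>

lemma hom_dual_volume_class_eq:
  assumes lim: "\<And>u. u \<in> sphere 0 1 \<Longrightarrow> ((\<lambda>t. G t u) \<longlongrightarrow> 0) (at_right 0)"
  shows "hom_dual_volume_class G = dual_volume_class (\<lambda>t u. G (t / hom_dual_volume G (cball 0 1)) u)"
proof -
  define \<eta> where "\<eta> = hom_dual_volume G (cball 0 1)"
  have \<eta>: "0 < \<eta>" unfolding \<eta>_def using lim by (rule hom_dual_volume_cball_pos)
  have "Inf {r. 0 < r \<and> weight_integral (\<lambda>u. r * 1) \<le> 1} = \<eta>"
    unfolding \<eta>_def hom_dual_volume_eq_Inf dual_volume_rescaled ..
  then have one: "weight_integral (\<lambda>u. \<eta> * 1) = 1"
    using Inf_scale_eq_iff(2)[OF lim continuous_on_const zero_less_one \<eta>] by blast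
  have "hom_dual_volume G (polar_body Q) = \<eta> \<longleftrightarrow> dual_volume (\<lambda>t u. G (t / \<eta>) u) (polar_body Q) = 1"
    if Q: "Q \<in> convex_bodies_o" for Q
    unfolding hom_dual_volume_eq_Inf dual_volume_rescaled(1)[OF Q]
    using Q by (intro Inf_scale_eq_iff(2) lim \<eta> continuous_on_support_function support_function_pos) auto
  then show ?thesis
    unfolding hom_dual_volume_class_def dual_volume_class_def \<eta>_def[symmetric] dual_volume_rescaled(2) one
    by blast
qed

lemma radial_weight_rescaled:
  assumes \<eta>: "0 < \<eta>"
  shows "radial_weight (\<lambda>t u. G (t / \<eta>) u)"
proof
  show "2 \<le> DIM('a)" by (rule dim)
  have "continuous_on ({0<..} \<times> sphere 0 1) (\<lambda>z. case (fst z / \<eta>, snd z :: 'a) of (t, u) \<Rightarrow> G t u)"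
    using \<eta> by (intro continuous_on_compose2[OF continuous_weight]) (auto intro!: continuous_intros)
  then show "continuous_on ({0<..} \<times> sphere 0 1) (\<lambda>(t, u). G (t / \<eta>) u)"
    by (simp add: case_prod_unfold)
  show "0 < G (t / \<eta>) u" if "0 < t" "u \<in> sphere 0 1" for t u
    using that \<eta> by (intro weight_pos) auto
  show "strict_mono_on {0<..} (\<lambda>t. G (t / \<eta>) u)" if "u \<in> sphere 0 1" for u
    using \<eta> by (intro strict_mono_onI strict_mono_onD[OF weight_mono[OF that]]) (auto simp: divide_strict_right_mono)
  obtain c T where c: "0 < c" and T: "0 < T"
    and gr: "\<And>t u. T \<le> t \<Longrightarrow> u \<in> sphere 0 1 \<Longrightarrow> c * t ^ (DIM('a) - 1) \<le> G t u"
    using growth by blast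
  have "c / \<eta> ^ (DIM('a) - 1) * t ^ (DIM('a) - 1) \<le> G (t / \<eta>) u" if "T * \<eta> \<le> t" "u \<in> sphere 0 1" for t u
    using gr[of "t / \<eta>" u] that \<eta> by (simp add: pos_le_divide_eq power_divide)
  then show "\<exists>c>0. \<exists>T>0. \<forall>t\<ge>T. \<forall>u\<in>sphere 0 1. c * t ^ (DIM('a) - 1) \<le> G (t / \<eta>) u"
    using c T \<eta> by (intro exI[of _ "c / \<eta> ^ (DIM('a) - 1)"] conjI exI[of _ "T * \<eta>"]) auto
qed

end

section \<open>From the hypotheses of the theorem to the abstract weights\<close>

lemma convex_on_rescale:
  fixes g :: "real \<Rightarrow> real"
  assumes "convex_on {0<..} g" "0 < \<eta>"
  shows "convex_on {0<..} (\<lambda>t. g (t / \<eta>))"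
proof (rule convex_onI)
  fix t x y :: real assume "0 < t" "t < 1" "x \<in> {0<..}" "y \<in> {0<..}"
  then show "g (((1 - t) *\<^sub>R x + t *\<^sub>R y) / \<eta>) \<le> (1 - t) * g (x / \<eta>) + t * g (y / \<eta>)"
    using convex_onD[OF assms(1), of t "x / \<eta>" "y / \<eta>"] assms(2) by (simp add: add_divide_distrib)
qed simp

text \<open>Positivity of \<open>G\<close> bounds the quotients from below, so the real
  \<open>INF\<close> is a genuine lower bound for each of them. For \<open>t \<ge> 1\<close> the
  power with exponent \<open>q\<close> dominates the one with exponent n-1.\<close>

lemma radial_weightI:
  fixes G :: "real \<Rightarrow> 'a::euclidean_space \<Rightarrow> real"
  assumes dim: "2 \<le> DIM('a)" and G: "G \<in> class_G_I"
    and growth: "\<exists>q \<ge> real DIM('a) - 1. 0 < (INF (t, u)\<in>{1..} \<times> sphere 0 1. G t u / t powr q)"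
  shows "radial_weight G"
proof
  obtain q where q: "real DIM('a) - 1 \<le> q" and c: "0 < (INF (t, u)\<in>{1..} \<times> sphere 0 1. G t u / t powr q)" (is "0 < ?c")
    using growth by blast
  have pos: "0 < G t u" if "0 < t" "u \<in> sphere 0 1" for t u using G that by (auto simp: class_G_I_def)
  have "?c * t ^ (DIM('a) - 1) \<le> G t u" if "1 \<le> t" "u \<in> sphere 0 1" for t u
  proof -
    have "bdd_below ((\<lambda>(t, u). G t u / t powr q) ` ({1..} \<times> sphere 0 1))"
      using pos by (intro bdd_belowI[of _ 0]) (auto intro!: divide_nonneg_nonneg less_imp_le)
    then have "?c \<le> (case (t, u) of (t, u) \<Rightarrow> G t u / t powr q)"
      using that by (intro cINF_lower) auto
    then have "?c * t powr q \<le> G t u" using that by (simp add: pos_le_divide_eq)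
    moreover have "t ^ (DIM('a) - 1) = t powr (real DIM('a) - 1)"
      using that dim powr_realpow[of t "DIM('a) - 1"] by (simp add: of_nat_diff)
    then have "?c * t ^ (DIM('a) - 1) \<le> ?c * t powr q"
      using that q c by (intro mult_left_mono) (auto intro: powr_mono)
    ultimately show ?thesis by linarith
  qed
  then show "\<exists>c>0. \<exists>T>0. \<forall>t\<ge>T. \<forall>u\<in>sphere 0 1. c * t ^ (DIM('a) - 1) \<le> G t u"
    using c by (intro exI[of _ ?c] conjI exI[of _ 1]) auto
qed (use dim G in \<open>auto simp: class_G_I_def\<close>)

theorem theorem5p4:
  fixes \<phi> :: "real \<Rightarrow> real" and \<mu> :: "(real ^ 'n) measure" and G :: "real \<Rightarrow> real ^ 'n \<Rightarrow> real"
  assumes n: "2 \<le> CARD('n)"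
    and \<phi>: "\<phi> \<in> class_I"
    and \<mu>: "finite_borel_measure_on_sphere \<mu>" "measure \<mu> (sphere 0 1) \<noteq> 0"
      "not_concentrated_on_closed_hemisphere \<mu>"
    and G: "G \<in> class_G_I"
    and growth: "\<exists>q \<ge> real CARD('n) - 1. 0 < (INF (t, u)\<in>{1..} \<times> sphere 0 1. G t u / t powr q)"
  shows
    "((\<exists>M\<in>dual_volume_class G.
         orlicz_norm \<mu> \<phi> (support_function M)
           = (INF Q\<in>dual_volume_class G. orlicz_norm \<mu> \<phi> (support_function Q)))
      \<and> (convex_on {0<..} \<phi> \<and> (\<forall>u\<in>sphere 0 1. convex_on {0<..} (\<lambda>t. G t u)) \<longrightarrow>
          (\<exists>!M. M \<in> dual_volume_class G \<and>
            orlicz_norm \<mu> \<phi> (support_function M)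
              = (INF Q\<in>dual_volume_class G. orlicz_norm \<mu> \<phi> (support_function Q)))))
   \<and> ((\<exists>M\<in>hom_dual_volume_class G.
         orlicz_norm \<mu> \<phi> (support_function M)
           = (INF Q\<in>hom_dual_volume_class G. orlicz_norm \<mu> \<phi> (support_function Q)))
      \<and> (convex_on {0<..} \<phi> \<and> (\<forall>u\<in>sphere 0 1. convex_on {0<..} (\<lambda>t. G t u)) \<longrightarrow>
          (\<exists>!M. M \<in> hom_dual_volume_class G \<and>
            orlicz_norm \<mu> \<phi> (support_function M)
              = (INF Q\<in>hom_dual_volume_class G. orlicz_norm \<mu> \<phi> (support_function Q)))))"
proof -
  interpret W: radial_weight G
    using n G growth by (intro radial_weightI) auto
  have data: "orlicz_data \<phi> \<mu>"
    using \<phi> \<mu> by unfold_locales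
  have lim: "((\<lambda>t. G t u) \<longlongrightarrow> 0) (at_right 0)" if "u \<in> sphere 0 1" for u
    using G that by (auto simp: class_G_I_def)
  define \<eta> where "\<eta> = hom_dual_volume G (cball 0 1)"
  have \<eta>: "0 < \<eta>" unfolding \<eta>_def using lim by (rule W.hom_dual_volume_cball_pos)
  have hom: "hom_dual_volume_class G = dual_volume_class (\<lambda>t u. G (t / \<eta>) u)"
    unfolding \<eta>_def using lim by (rule W.hom_dual_volume_class_eq)
  \<comment> \<open>\<open>D\<close> yields the statements on dual volumes and \<open>E\<close>
    those on homogeneous dual volumes, through the identity \<open>hom\<close>.\<close>
  interpret D: dual_orlicz G \<phi> \<mu>
    by (rule dual_orlicz.intro[OF W.radial_weight_axioms data])
  interpret E: dual_orlicz "\<lambda>t u. G (t / \<eta>) u" \<phi> \<mu>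
    by (rule dual_orlicz.intro[OF W.radial_weight_rescaled[OF \<eta>] data])
  show ?thesis
    unfolding hom
    by (intro conjI impI D.minimizer_exists E.minimizer_exists D.minimizer_ex1 E.minimizer_ex1
        convex_on_rescale \<eta>) auto
qed

end
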